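(* Fix $\ell=(\ell_1,\dots,\ell_k)$ with all $\ell_j\ge2$, and let $c=(c_{ij})_{1\le i<j\le k}$ with $c_{ij}\in\mathbb{Z}_{\le0}^{\ell_j}$ be a parameter with matrix $\pi=\pi(\ell,c)$ and associated splitting fan $\Sigma=\Sigma(\ell,c)$. Then: (i) $\operatorname{Seed}(\ell)\subseteq\operatorname{Imm}_{\mathbb{R}}(\Sigma(\ell,c))$ for all $c$, that is, the generating seeds are really immaculate. (ii) Both loci $\operatorname{Imm}_{\mathbb{Z}}(\Sigma)$ and $\operatorname{Imm}_{\mathbb{R}}(\Sigma)$ are closed under the $c$-hull operation. (iii) If for each $j=1,\dots,k-1$ the vector $c_{j,j+1}\in\mathbb{Z}^{\ell_{j+1}}$ has at least two entries differing by more than $\ell_j$, then the immaculate loci are both equal to the minimal subset of $\mathbb{Z}^k$ that contains $\operatorname{Seed}(\ell)$ and is closed under the $c$-hull operation, i.e. $\operatorname{Imm}_{\mathbb{Z}}(\Sigma(\ell,c))=\operatorname{Imm}_{\mathbb{R}}(\Sigma(\ell,c))=\langle\operatorname{Seed}(\ell)\rangle_c$.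
   Context: Base field $\Bbbk$ algebraically closed. $\pi(\ell,c)$ is the block upper triangular integer matrix with $k$ rows and $k$ column blocks of sizes $\ell_1,\dots,\ell_k$ whose $(i,j)$ block is the all-ones row vector if $i=j$, zero if $i>j$, and $c_{ij}=(c_{ij}^1,\dots,c_{ij}^{\ell_j})$ if $i<j$. The fan $\Sigma(\ell,c)$ lives in $N=\mathbb{Z}^{\ell_1+\dots+\ell_k}/(\text{row span of }\pi)$; its rays are the images of the standard basis vectors, and a set of rays spans a cone iff it does not contain all rays of any one of the $k$ blocks. It is a smooth complete fan whose primitive collections are the $k$ blocks (a splitting fan). Let $X$ be its toric variety; $\pi$ is the class map $\mathbb{Z}^{\Sigma(1)}\to\operatorname{Cl}(X)=\mathbb{Z}^k$. Generating immaculate seed: $\operatorname{Seed}(\ell):=\bigcup_{j=1}^k\bigl(\mathbb{Z}^{j-1}\times\{-1,\dots,-(\ell_j-1)\}\times\{0\}^{k-j}\bigr)\subseteq\mathbb{Z}^k$. Hull: put $\overline{c}_{ij}=\sum_{\nu=1}^{\ell_j}c_{ij}^\nu$ and $v_j=(\overline{c}_{1j},\dots,\overline{c}_{j-1,j},\ell_j,0,\dots,0)\in\mathbb{Z}^k$. For $G\subseteq\mathbb{Z}^k$ the $c$-hull $\langle G\rangle_c$ is the smallest set containing $G$ such that, for every $j=0,\dots,k-1$, if $a\in\langle G\rangle_c\cap(\mathbb{Z}^j\times\{0\}^{k-j})$ then $a-v_{j+1}\in\langle G\rangle_c$. A set is closed under the $c$-hull operation if it equals its $c$-hull. Immaculate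 loci: a space is $\Bbbk$-acyclic if it is non-empty, arcwise connected, with vanishing positive-degree singular cohomology over $\Bbbk$. $\mathcal{R}\subseteq\Sigma(1)$ is tempting if $V^{>}(\mathcal{R})=\mathbb{R}_{>0}\cdot\bigcup_{\sigma\in\Sigma}\operatorname{conv}(\mathcal{R}\cap\sigma(1))\subseteq N_{\mathbb{R}}$ is not $\Bbbk$-acyclic. Put $\mathcal{M}_{\mathbb{Z}}(\mathcal{R})=\pi(\mathbb{Z}_{\ge0}^{\Sigma(1)\setminus\mathcal{R}}\times\mathbb{Z}_{\le-1}^{\mathcal{R}})$, $\mathcal{M}_{\mathbb{R}}(\mathcal{R})=\pi(\mathbb{R}_{\ge0}^{\Sigma(1)\setminus\mathcal{R}}\times\mathbb{R}_{\le-1}^{\mathcal{R}})\subseteq\mathbb{R}^k$. Then $\operatorname{Imm}_{\mathbb{Z}}(\Sigma)=\mathbb{Z}^k\setminus\bigcup_{\mathcal{R}\text{ tempting}}\mathcal{M}_{\mathbb{Z}}(\mathcal{R})$, which is the set of immaculate classes (those with $H^i(X,\mathcal{O}_X(D))=0$ for all $i\ge0$), and $\operatorname{Imm}_{\mathbb{R}}(\Sigma)=\mathbb{Z}^k\setminus\bigcup_{\mathcal{R}\text{ tempting}}\mathcal{M}_{\mathbb{R}}(\mathcal{R})$, the set of really immaculate classes. *)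

theory Defs
  imports
    "HOL-Homology.Homology"
    "HOL-Computational_Algebra.Polynomial"
begin

section \<open>The matrix \<open>\<pi>(\<ell>, c)\<close> and the class map\<close>

text \<open>
  Throughout, \<open>k\<close> is the number of blocks, \<open>ell j\<close> (for \<open>1 \<le> j \<le> k\<close>) the size of the
  \<open>j\<close>-th block, and \<open>c i j \<nu>\<close> (for \<open>1 \<le> i < j \<le> k\<close> and \<open>1 \<le> \<nu> \<le> ell j\<close>) the \<open>\<nu>\<close>-th entry of
  the vector \<open>c\<^sub>i\<^sub>j\<close>.  Values of \<open>ell\<close> and \<open>c\<close> at other arguments are never used.
  All indices are 1-based.  The pair \<open>(j, \<nu>)\<close> stands for the \<open>\<nu>\<close>-th column of the \<open>j\<close>-th block,
  equivalently for the corresponding ray.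
\<close>

definition ray_index :: "nat \<Rightarrow> (nat \<Rightarrow> nat) \<Rightarrow> (nat \<times> nat) set" where
  "ray_index k ell = (SIGMA j:{1..k}. {1..ell j})"

definition pi_entry :: "(nat \<Rightarrow> nat \<Rightarrow> nat \<Rightarrow> int) \<Rightarrow> nat \<Rightarrow> nat \<times> nat \<Rightarrow> int" where
  "pi_entry c i r =
     (case r of (j, \<nu>) \<Rightarrow> if i = j then 1 else if i < j then c i j \<nu> else 0)"

text \<open>
  Elements of \<open>\<int>\<^sup>k\<close> and \<open>\<real>\<^sup>k\<close> are functions on \<open>nat\<close> vanishing outside \<open>{1..k}\<close>, so for \<open>j \<le> k\<close> the
  set \<open>\<int>\<^sup>j \<times> {0}\<^sup>k\<^sup>-\<^sup>j\<close> is literally \<open>Zpow j\<close>.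
\<close>

definition Zpow :: "nat \<Rightarrow> (nat \<Rightarrow> int) set" where
  "Zpow k = {a. \<forall>i. i \<notin> {1..k} \<longrightarrow> a i = 0}"

definition class_map ::
  "nat \<Rightarrow> (nat \<Rightarrow> nat) \<Rightarrow> (nat \<Rightarrow> nat \<Rightarrow> nat \<Rightarrow> int) \<Rightarrow>
   (nat \<times> nat \<Rightarrow> 'a::comm_ring_1) \<Rightarrow> nat \<Rightarrow> 'a" where
  "class_map k ell c x =
     (\<lambda>i. if i \<in> {1..k} then (\<Sum>r\<in>ray_index k ell. of_int (pi_entry c i r) * x r) else 0)"

section \<open>The space \<open>N\<^sub>\<real>\<close> and the splitting fan\<close>

text \<open>
  \<open>N\<^sub>\<real> = N \<otimes> \<real>\<close> is the quotient of \<open>\<real>\<^bsup>\<Sigma>(1)\<^esup>\<close> by the real row span of \<open>\<pi>\<close>; its elements are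
  the cosets, and it carries the quotient topology.
\<close>

definition Rrays :: "nat \<Rightarrow> (nat \<Rightarrow> nat) \<Rightarrow> (nat \<times> nat \<Rightarrow> real) set" where
  "Rrays k ell = {x. \<forall>r. r \<notin> ray_index k ell \<longrightarrow> x r = 0}"

definition row_span ::
  "nat \<Rightarrow> (nat \<Rightarrow> nat) \<Rightarrow> (nat \<Rightarrow> nat \<Rightarrow> nat \<Rightarrow> int) \<Rightarrow> (nat \<times> nat \<Rightarrow> real) set" where
  "row_span k ell c =
     {\<lambda>r. if r \<in> ray_index k ell then (\<Sum>i=1..k. lam i * of_int (pi_entry c i r)) else 0
      | lam. True}"

definition N_proj ::
  "nat \<Rightarrow> (nat \<Rightarrow> nat) \<Rightarrow> (nat \<Rightarrow> nat \<Rightarrow> nat \<Rightarrow> int) \<Rightarrow>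
   (nat \<times> nat \<Rightarrow> real) \<Rightarrow> (nat \<times> nat \<Rightarrow> real) set" where
  "N_proj k ell c x = {\<lambda>r. x r + y r | y. y \<in> row_span k ell c}"

definition N_space ::
  "nat \<Rightarrow> (nat \<Rightarrow> nat) \<Rightarrow> (nat \<Rightarrow> nat \<Rightarrow> nat \<Rightarrow> int) \<Rightarrow> (nat \<times> nat \<Rightarrow> real) set set" where
  "N_space k ell c = N_proj k ell c ` Rrays k ell"

definition N_top ::
  "nat \<Rightarrow> (nat \<Rightarrow> nat) \<Rightarrow> (nat \<Rightarrow> nat \<Rightarrow> nat \<Rightarrow> int) \<Rightarrow> (nat \<times> nat \<Rightarrow> real) set topology" where
  "N_top k ell c = topology (\<lambda>U. U \<subseteq> N_space k ell c \<and>
     openin (subtopology (powertop_real UNIV) (Rrays k ell))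
       {x \<in> Rrays k ell. N_proj k ell c x \<in> U})"

lemma openin_N_top:
  "openin (N_top k ell c) U \<longleftrightarrow>
     U \<subseteq> N_space k ell c \<and>
     openin (subtopology (powertop_real UNIV) (Rrays k ell))
       {x \<in> Rrays k ell. N_proj k ell c x \<in> U}"
proof -
  let ?E = "subtopology (powertop_real UNIV) (Rrays k ell)"
  let ?P = "\<lambda>U. {x \<in> Rrays k ell. N_proj k ell c x \<in> U}"
  have "istopology (\<lambda>U. U \<subseteq> N_space k ell c \<and> openin ?E (?P U))"
    unfolding istopology_def
  proof (intro conjI allI impI)
    fix S T
    assume "S \<subseteq> N_space k ell c \<and> openin ?E (?P S)" "T \<subseteq> N_space k ell c \<and> openin ?E (?P T)"
    moreover have "?P (S \<inter> T) = ?P S \<inter> ?P T" by auto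
    ultimately show "S \<inter> T \<subseteq> N_space k ell c" "openin ?E (?P (S \<inter> T))"
      by auto
  next
    fix K
    assume K: "\<forall>U\<in>K. U \<subseteq> N_space k ell c \<and> openin ?E (?P U)"
    then show "\<Union>K \<subseteq> N_space k ell c" by auto
    have "?P (\<Union>K) = \<Union>(?P ` K)" by auto
    moreover have "openin ?E (\<Union>(?P ` K))"
      using K by (intro openin_Union) auto
    ultimately show "openin ?E (?P (\<Union>K))" by simp
  qed
  then show ?thesis
    by (simp add: N_top_def)
qed

definition ray_gen ::
  "nat \<Rightarrow> (nat \<Rightarrow> nat) \<Rightarrow> (nat \<Rightarrow> nat \<Rightarrow> nat \<Rightarrow> int) \<Rightarrow> nat \<times> nat \<Rightarrow> (nat \<times> nat \<Rightarrow> real) set" where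
  "ray_gen k ell c r = N_proj k ell c (\<lambda>s. if s = r then 1 else 0)"

text \<open>
  For \<open>x\<close> supported in \<open>S\<close>, the class of \<open>x\<close> is the linear combination of the ray generators
  \<open>ray_gen r\<close>, \<open>r \<in> S\<close>, with coefficients \<open>x r\<close>.  The following two sets are therefore the cone
  generated by, and the convex hull of, the ray generators indexed by \<open>S\<close>.
\<close>

definition N_cone ::
  "nat \<Rightarrow> (nat \<Rightarrow> nat) \<Rightarrow> (nat \<Rightarrow> nat \<Rightarrow> nat \<Rightarrow> int) \<Rightarrow>
   (nat \<times> nat) set \<Rightarrow> (nat \<times> nat \<Rightarrow> real) set set" where
  "N_cone k ell c S = N_proj k ell c ` {x. (\<forall>r. r \<notin> S \<longrightarrow> x r = 0) \<and> (\<forall>r\<in>S. 0 \<le> x r)}"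

definition N_conv ::
  "nat \<Rightarrow> (nat \<Rightarrow> nat) \<Rightarrow> (nat \<Rightarrow> nat \<Rightarrow> nat \<Rightarrow> int) \<Rightarrow>
   (nat \<times> nat) set \<Rightarrow> (nat \<times> nat \<Rightarrow> real) set set" where
  "N_conv k ell c S =
     N_proj k ell c ` {x. (\<forall>r. r \<notin> S \<longrightarrow> x r = 0) \<and> (\<forall>r\<in>S. 0 \<le> x r) \<and> (\<Sum>r\<in>S. x r) = 1}"

text \<open>Scaling a coset elementwise is scalar multiplication on the quotient for \<open>t \<noteq> 0\<close>.\<close>

definition N_scale :: "real \<Rightarrow> (nat \<times> nat \<Rightarrow> real) set \<Rightarrow> (nat \<times> nat \<Rightarrow> real) set" where
  "N_scale t \<xi> = (\<lambda>x r. t * x r) ` \<xi>"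

definition splitting_fan ::
  "nat \<Rightarrow> (nat \<Rightarrow> nat) \<Rightarrow> (nat \<Rightarrow> nat \<Rightarrow> nat \<Rightarrow> int) \<Rightarrow> (nat \<times> nat \<Rightarrow> real) set set set" where
  "splitting_fan k ell c =
     N_cone k ell c ` {S. S \<subseteq> ray_index k ell \<and> (\<forall>j\<in>{1..k}. \<not> {j} \<times> {1..ell j} \<subseteq> S)}"

definition cone_rays ::
  "nat \<Rightarrow> (nat \<Rightarrow> nat) \<Rightarrow> (nat \<Rightarrow> nat \<Rightarrow> nat \<Rightarrow> int) \<Rightarrow>
   (nat \<times> nat \<Rightarrow> real) set set \<Rightarrow> (nat \<times> nat) set" where
  "cone_rays k ell c \<sigma> = {r \<in> ray_index k ell. ray_gen k ell c r \<in> \<sigma>}"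

section \<open>Acyclicity and tempting sets of rays\<close>

text \<open>
  A singular \<open>p\<close>-cochain of \<open>X\<close> with values in \<open>'f\<close> is represented by a function whose values
  outside the singular \<open>p\<close>-simplices of \<open>X\<close> are irrelevant.
\<close>

definition cochain_coboundary ::
  "nat \<Rightarrow> (((nat \<Rightarrow> real) \<Rightarrow> 'a) \<Rightarrow> 'f::field) \<Rightarrow> ((nat \<Rightarrow> real) \<Rightarrow> 'a) \<Rightarrow> 'f" where
  "cochain_coboundary p \<phi> s = (\<Sum>i\<le>Suc p. (-1) ^ i * \<phi> (singular_face (Suc p) i s))"

definition singular_cocycle ::
  "nat \<Rightarrow> 'a topology \<Rightarrow> (((nat \<Rightarrow> real) \<Rightarrow> 'a) \<Rightarrow> 'f::field) \<Rightarrow> bool" where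
  "singular_cocycle p X \<phi> \<longleftrightarrow>
     (\<forall>s. singular_simplex (Suc p) X s \<longrightarrow> cochain_coboundary p \<phi> s = 0)"

text \<open>Degree \<open>Suc p\<close>: the cochain is the coboundary of a \<open>p\<close>-cochain.\<close>

definition singular_coboundary_Suc ::
  "nat \<Rightarrow> 'a topology \<Rightarrow> (((nat \<Rightarrow> real) \<Rightarrow> 'a) \<Rightarrow> 'f::field) \<Rightarrow> bool" where
  "singular_coboundary_Suc p X \<phi> \<longleftrightarrow>
     (\<exists>\<psi>. \<forall>s. singular_simplex (Suc p) X s \<longrightarrow> \<phi> s = cochain_coboundary p \<psi> s)"

definition field_acyclic :: "'f::field itself \<Rightarrow> 'a topology \<Rightarrow> bool" where
  "field_acyclic _ X \<longleftrightarrow>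
     topspace X \<noteq> {} \<and> path_connected_space X \<and>
     (\<forall>p. \<forall>\<phi> :: ((nat \<Rightarrow> real) \<Rightarrow> 'a) \<Rightarrow> 'f.
        singular_cocycle (Suc p) X \<phi> \<longrightarrow> singular_coboundary_Suc p X \<phi>)"

definition V_gt ::
  "nat \<Rightarrow> (nat \<Rightarrow> nat) \<Rightarrow> (nat \<Rightarrow> nat \<Rightarrow> nat \<Rightarrow> int) \<Rightarrow>
   (nat \<times> nat) set \<Rightarrow> (nat \<times> nat \<Rightarrow> real) set set" where
  "V_gt k ell c R =
     {N_scale t \<xi> | t \<xi>. t > 0 \<and>
        \<xi> \<in> (\<Union>\<sigma>\<in>splitting_fan k ell c. N_conv k ell c (R \<inter> cone_rays k ell c \<sigma>))}"

definition tempting ::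
  "'f::field itself \<Rightarrow> nat \<Rightarrow> (nat \<Rightarrow> nat) \<Rightarrow> (nat \<Rightarrow> nat \<Rightarrow> nat \<Rightarrow> int) \<Rightarrow>
   (nat \<times> nat) set \<Rightarrow> bool" where
  "tempting F k ell c R \<longleftrightarrow>
     R \<subseteq> ray_index k ell \<and>
     \<not> field_acyclic F (subtopology (N_top k ell c) (V_gt k ell c R))"

section \<open>Immaculate loci\<close>

definition M_int ::
  "nat \<Rightarrow> (nat \<Rightarrow> nat) \<Rightarrow> (nat \<Rightarrow> nat \<Rightarrow> nat \<Rightarrow> int) \<Rightarrow>
   (nat \<times> nat) set \<Rightarrow> (nat \<Rightarrow> int) set" where
  "M_int k ell c R = class_map k ell c `
     {x. (\<forall>r\<in>ray_index k ell - R. 0 \<le> x r) \<and> (\<forall>r\<in>R. x r \<le> -1)}"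

definition M_real ::
  "nat \<Rightarrow> (nat \<Rightarrow> nat) \<Rightarrow> (nat \<Rightarrow> nat \<Rightarrow> nat \<Rightarrow> int) \<Rightarrow>
   (nat \<times> nat) set \<Rightarrow> (nat \<Rightarrow> real) set" where
  "M_real k ell c R = class_map k ell c `
     {x. (\<forall>r\<in>ray_index k ell - R. 0 \<le> x r) \<and> (\<forall>r\<in>R. x r \<le> -1)}"

definition Imm_int ::
  "'f::field itself \<Rightarrow> nat \<Rightarrow> (nat \<Rightarrow> nat) \<Rightarrow> (nat \<Rightarrow> nat \<Rightarrow> nat \<Rightarrow> int) \<Rightarrow> (nat \<Rightarrow> int) set" where
  "Imm_int F k ell c = Zpow k - (\<Union>R\<in>{R. tempting F k ell c R}. M_int k ell c R)"

definition Imm_real ::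
  "'f::field itself \<Rightarrow> nat \<Rightarrow> (nat \<Rightarrow> nat) \<Rightarrow> (nat \<Rightarrow> nat \<Rightarrow> nat \<Rightarrow> int) \<Rightarrow> (nat \<Rightarrow> int) set" where
  "Imm_real F k ell c =
     {a \<in> Zpow k. (\<lambda>i. real_of_int (a i)) \<notin> (\<Union>R\<in>{R. tempting F k ell c R}. M_real k ell c R)}"

section \<open>The generating seed and the \<open>c\<close>-hull\<close>

definition Seed :: "nat \<Rightarrow> (nat \<Rightarrow> nat) \<Rightarrow> (nat \<Rightarrow> int) set" where
  "Seed k ell = (\<Union>j\<in>{1..k}. {a \<in> Zpow j. a j \<in> {- (int (ell j) - 1)..-1}})"

definition hull_vec ::
  "(nat \<Rightarrow> nat) \<Rightarrow> (nat \<Rightarrow> nat \<Rightarrow> nat \<Rightarrow> int) \<Rightarrow> nat \<Rightarrow> nat \<Rightarrow> int" where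
  "hull_vec ell c j =
     (\<lambda>i. if 1 \<le> i \<and> i < j then (\<Sum>\<nu>=1..ell j. c i j \<nu>)
          else if i = j then int (ell j) else 0)"

inductive_set c_hull ::
  "nat \<Rightarrow> (nat \<Rightarrow> nat) \<Rightarrow> (nat \<Rightarrow> nat \<Rightarrow> nat \<Rightarrow> int) \<Rightarrow> (nat \<Rightarrow> int) set \<Rightarrow> (nat \<Rightarrow> int) set"
  for k :: nat and ell :: "nat \<Rightarrow> nat" and c :: "nat \<Rightarrow> nat \<Rightarrow> nat \<Rightarrow> int" and G :: "(nat \<Rightarrow> int) set"
  where
    base: "a \<in> G \<Longrightarrow> a \<in> c_hull k ell c G"
  | step: "a \<in> c_hull k ell c G \<Longrightarrow> j < k \<Longrightarrow> a \<in> Zpow j \<Longrightarrow>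
           (\<lambda>i. a i - hull_vec ell c (Suc j) i) \<in> c_hull k ell c G"

definition c_hull_closed ::
  "nat \<Rightarrow> (nat \<Rightarrow> nat) \<Rightarrow> (nat \<Rightarrow> nat \<Rightarrow> nat \<Rightarrow> int) \<Rightarrow> (nat \<Rightarrow> int) set \<Rightarrow> bool" where
  "c_hull_closed k ell c G \<longleftrightarrow> G = c_hull k ell c G"

end

theory Submission
  imports Defs "HOL-Analysis.Ordered_Euclidean_Space"
begin

text \<open>
  The topology and the arithmetic separate completely, because the parameter \<open>c\<close> disappears
  from the topology.  Modulo the rows of \<open>\<pi>\<close> every vector has a unique
  representative whose minimum over each block is zero: clear the blocks from left to right,
  which is possible because \<open>\<pi>\<close> is block triangular.  This normal form depends continuously on
  the vector, so \<open>N\<^sub>\<real>\<close> is homeomorphic to the set of block-reduced vectors, and the cones of the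
  fan become the coordinate cones in that set.  In these coordinates \<open>V\<^sup>>(R)\<close> is the set of nonzero
  block-reduced vectors supported in \<open>R\<close> (\<open>V_gt_homeomorphic\<close>).

  If \<open>R\<close> meets some block in a proper nonempty part, this set is star-shaped about a ray of \<open>R\<close>
  in that block, since a ray of the block outside \<open>R\<close> keeps the block minimum at zero; hence it
  is contractible.  If \<open>R\<close> is a nonempty union of blocks, then taking differences within blocks
  identifies it with a punctured Euclidean space, which retracts onto a sphere; for \<open>R = {}\<close>
  it is empty.  So the tempting sets are precisely the unions of blocks
  (\<open>tempting_iff_block_union\<close>).  To speak about cohomology over a field while knowing integral
  homology of spheres and of contractible spaces, homomorphisms from groups of cycles or
  boundaries to the field are extended to all chains.  These subgroups are pure, and for a pure
  subgroup such an extension exists in every characteristic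
  (\<open>additive_extension_from_pure_subgroup\<close>).

  The arithmetic is carried by the last nonzero coordinate.  Let \<open>a = \<pi>(x)\<close>, where \<open>x \<le> -1\<close> on a
  union of blocks and \<open>x \<ge> 0\<close> elsewhere, and suppose that \<open>a\<close> vanishes beyond coordinate \<open>m\<close>.
  Reading the rows from below shows that \<open>x\<close> vanishes on the blocks beyond \<open>m\<close>, so \<open>a\<^sub>m\<close> is the
  sum of \<open>x\<close> over block \<open>m\<close> and is either nonnegative or at most \<open>-\<ell>\<^sub>m\<close>.  The seed avoids both
  ranges.  If \<open>a\<^sub>m = -\<ell>\<^sub>m\<close>, then \<open>x\<close> is constantly \<open>-1\<close> on block \<open>m\<close>; removing the block adds the
  hull vector to \<open>a\<close>, and this gives closure of the immaculate loci.

  Conversely a class outside the hull is reached by induction on \<open>m\<close>.  The values \<open>a\<^sub>m\<close> between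
  \<open>-\<ell>\<^sub>m\<close> and \<open>0\<close> are covered by the induction hypothesis, by the seed and by one hull step.  For
  every other value there is a choice of the entry of block \<open>m\<close> that absorbs the excess.  For
  \<open>m > 1\<close> the gap condition provides two choices whose remainders differ in coordinate \<open>m - 1\<close> by
  more than \<open>\<ell>\<^bsub>m-1\<^esub>\<close>, whereas on the hull elements that vanish beyond \<open>m - 1\<close> this coordinate lies
  in an interval of length \<open>\<ell>\<^bsub>m-1\<^esub>\<close>; for \<open>m = 1\<close> the remainder is zero, and the hull does not
  contain zero.  So some choice leaves a remainder outside the hull (\<open>outside_hull_chamber_class\<close>).
\<close>

section \<open>Extending homomorphisms into a field\<close>

text \<open>
  Partial homomorphisms are handled through their graphs, which are subgroups \<open>M\<close> of the product;
  such a subgroup is single-valued as soon as it pairs zero only with zero.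
\<close>

lemma graph_int_multiple:
  fixes M :: "(('a \<Rightarrow>\<^sub>0 int) \<times> 'f::ring_1) set"
  assumes diff: "\<And>x a y b. (x, a) \<in> M \<Longrightarrow> (y, b) \<in> M \<Longrightarrow> (x - y, a - b) \<in> M"
    and "(x, a) \<in> M"
  shows "(frag_cmul m x, of_int m * a) \<in> M"
proof -
  have 0: "(0, 0) \<in> M"
    using diff[OF assms(2) assms(2)] by simp
  have neg: "(- y, - b) \<in> M" if "(y, b) \<in> M" for y b
    using diff[OF 0 that] by simp
  have add: "(y + z, b + d) \<in> M" if "(y, b) \<in> M" "(z, d) \<in> M" for y b z d
    using diff[OF that(1) neg[OF that(2)]] by simp
  have nat: "(frag_cmul (int n) x, of_nat n * a) \<in> M" for n
  proof (induction n)
    case 0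
    then show ?case using \<open>(0, 0) \<in> M\<close> by simp
  next
    case (Suc n)
    then show ?case
      using add[OF assms(2) Suc] by (simp add: frag_cmul_distrib algebra_simps)
  qed
  show ?thesis
  proof (cases m)
    case (nonneg n)
    then show ?thesis using nat by simp
  next
    case (neg n)
    have "(- frag_cmul (int (Suc n)) x, - (of_nat (Suc n) * a)) \<in> M"
      by (rule \<open>\<And>y b. (y, b) \<in> M \<Longrightarrow> (- y, - b) \<in> M\<close>[OF nat])
    then show ?thesis
      unfolding neg by (simp only: minus_frag_cmul of_int_minus of_int_of_nat_eq mult_minus_left)
  qed
qed

text \<open>
  Let \<open>C\<close> be the whole group and \<open>p\<close> the characteristic.  For \<open>p > 0\<close> the field is not a
  divisible group, and a homomorphism that extends to \<open>C\<close> has to vanish on all elements of \<open>G\<close> that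
  are divisible by \<open>p\<close> in \<open>C\<close>.  Purity makes these the \<open>p\<close>-multiples of elements of \<open>G\<close>, where \<open>h\<close>
  vanishes already.  So \<open>h\<close> extends to \<open>G + pC\<close> with value zero on \<open>pC\<close> (its graph is \<open>\<Gamma>\<close>), and
  once \<open>pC\<close> is in the domain no further obstruction arises: Zorn's lemma applies.  For \<open>p = 0\<close>
  the enlargement is void.
\<close>

theorem additive_extension_from_pure_subgroup:
  fixes G :: "('a \<Rightarrow>\<^sub>0 int) set" and h :: "('a \<Rightarrow>\<^sub>0 int) \<Rightarrow> 'f::field"
  assumes G0: "0 \<in> G" and Gdiff: "\<And>x y. x \<in> G \<Longrightarrow> y \<in> G \<Longrightarrow> x - y \<in> G"
    and pure: "\<And>m x. frag_cmul m x \<in> G \<Longrightarrow> m \<noteq> 0 \<Longrightarrow> x \<in> G"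
    and h: "\<And>x y. x \<in> G \<Longrightarrow> y \<in> G \<Longrightarrow> h (x - y) = h x - h y"
  obtains H where "additive H" "\<And>x. x \<in> G \<Longrightarrow> H x = h x"
proof -
  define p where "p = int CHAR('f)"
  define \<Gamma> where "\<Gamma> = {(g + frag_cmul p z, h g) | g z. g \<in> G}"
  define A where "A = {M. \<Gamma> \<subseteq> M \<and> (\<forall>x a y b. (x, a) \<in> M \<longrightarrow> (y, b) \<in> M \<longrightarrow> (x - y, a - b) \<in> M)
      \<and> (\<forall>a. (0, a) \<in> M \<longrightarrow> a = 0)}"
  have p0: "of_int p = (0::'f)"
    by (simp add: p_def)
  have pdvd: "p dvd m" if "of_int m = (0::'f)" for m
  proof -
    have "of_nat (nat \<bar>m\<bar>) = (0::'f)"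
      using that by (simp add: of_nat_nat abs_if)
    then have "CHAR('f) dvd nat \<bar>m\<bar>"
      by (simp only: of_nat_eq_0_iff_char_dvd)
    then have "int CHAR('f) dvd int (nat \<bar>m\<bar>)"
      by (simp only: int_dvd_int_iff)
    then show ?thesis by (simp add: p_def)
  qed
  have h0: "h 0 = 0" using h[OF G0 G0] by simp
  have hp: "h (frag_cmul p z) = 0" if z: "z \<in> G" for z
  proof -
    let ?M = "{(x, h x) | x. x \<in> G}"
    have "(frag_cmul p z, of_int p * h z) \<in> ?M"
      by (rule graph_int_multiple) (use z Gdiff h in auto)
    then show ?thesis using p0 by auto
  qed
  have "\<Gamma> \<in> A"
  proof -
    have "(x - y, a - b) \<in> \<Gamma>" if xa: "(x, a) \<in> \<Gamma>" and yb: "(y, b) \<in> \<Gamma>" for x a y b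
    proof -
      obtain g z where 1: "x = g + frag_cmul p z" "a = h g" "g \<in> G" using xa by (auto simp: \<Gamma>_def)
      obtain g' z' where 2: "y = g' + frag_cmul p z'" "b = h g'" "g' \<in> G" using yb by (auto simp: \<Gamma>_def)
      have "x - y = (g - g') + frag_cmul p (z - z')" "a - b = h (g - g')" "g - g' \<in> G"
        using 1 2 h Gdiff by (auto simp: frag_cmul_distrib2 algebra_simps)
          (metis add.commute diff_add_cancel frag_cmul_distrib2)
      then show ?thesis unfolding \<Gamma>_def by blast
    qed
    moreover have "a = 0" if a: "(0, a) \<in> \<Gamma>" for a
    proof -
      obtain g z where "(0, a) = (g + frag_cmul p z, h g)" and gG: "g \<in> G"
        using a unfolding \<Gamma>_def by blast
      then have 1: "g + frag_cmul p z = 0" "a = h g" "g \<in> G" by auto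
      then have g: "g = frag_cmul p (- z)"
        by (metis add.commute add_eq_0_iff frag_cmul_cmul frag_cmul_minus_one mult.commute)
      show ?thesis
      proof (cases "p = 0")
        case True
        then show ?thesis using g 1 h0 by simp
      next
        case False
        then have "- z \<in> G" using pure g 1 by metis
        then show ?thesis using hp g 1 by metis
      qed
    qed
    ultimately show ?thesis by (auto simp: A_def)
  qed
  have "\<exists>M\<in>A. \<forall>X\<in>A. M \<subseteq> X \<longrightarrow> X = M"
  proof (rule subset_Zorn_nonempty)
    show "A \<noteq> {}" using \<open>\<Gamma> \<in> A\<close> by blast
    fix C assume C: "C \<noteq> {}" "subset.chain A C"
    then have CA: "X \<in> A" if "X \<in> C" for X
      using that by (auto simp: subset_chain_def)
    show "\<Union> C \<in> A"
      unfolding A_def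
    proof (intro CollectI conjI allI impI)
      show "\<Gamma> \<subseteq> \<Union> C" proof -
        obtain X where "X \<in> C" using C(1) by blast
        moreover from this have "\<Gamma> \<subseteq> X" using CA by (simp add: A_def)
        ultimately show ?thesis by blast
      qed
      show "a = 0" if "(0, a) \<in> \<Union> C" for a
        using that CA unfolding A_def by blast
      fix x a y b assume xa: "(x, a) \<in> \<Union> C" and yb: "(y, b) \<in> \<Union> C"
      then obtain X Y where XY: "X \<in> C" "(x, a) \<in> X" "Y \<in> C" "(y, b) \<in> Y" by blast
      then consider "X \<subseteq> Y" | "Y \<subseteq> X"
        using subset_chain_def C(2) by metis
      then obtain Z where "Z \<in> C" "(x, a) \<in> Z" "(y, b) \<in> Z"
        using XY by cases blast+
      then show "(x - y, a - b) \<in> \<Union> C"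
        using CA unfolding A_def by blast
    qed
  qed
  then obtain M where M: "M \<in> A" and max: "\<And>X. X \<in> A \<Longrightarrow> M \<subseteq> X \<Longrightarrow> X = M" by blast
  have \<Gamma>M: "\<Gamma> \<subseteq> M" and Mdiff: "\<And>x a y b. (x, a) \<in> M \<Longrightarrow> (y, b) \<in> M \<Longrightarrow> (x - y, a - b) \<in> M"
    and M0: "\<And>a. (0, a) \<in> M \<Longrightarrow> a = 0"
    using M by (auto simp: A_def)
  have Mfun: "a = b" if "(x, a) \<in> M" "(x, b) \<in> M" for x a b
    using Mdiff[OF that] M0 by fastforce
  have Mmult: "(frag_cmul m x, of_int m * a) \<in> M" if "(x, a) \<in> M" for m x a
    using graph_int_multiple[of M, OF Mdiff that] by blast
  have GM: "(g, h g) \<in> M" if "g \<in> G" for g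
    using \<Gamma>M that unfolding \<Gamma>_def by (force intro: exI[of _ 0])
  have pM: "(frag_cmul p z, 0) \<in> M" for z
    using \<Gamma>M h0 G0 unfolding \<Gamma>_def by force
  have total: "\<exists>a. (x, a) \<in> M" for x
  proof -
    \<comment> \<open>Choice of the value at \<open>x\<close>: it is forced as soon as some multiple \<open>m x\<close> with \<open>m\<close>
      invertible in the field lies in the domain, and free otherwise.\<close>
    obtain y :: 'f where y: "\<And>m a. (frag_cmul m x, a) \<in> M \<Longrightarrow> a = of_int m * y"
    proof (cases "\<exists>m a. (frag_cmul m x, a) \<in> M \<and> of_int m \<noteq> (0::'f)")
      case True
      then obtain m a where ma: "(frag_cmul m x, a) \<in> M" "of_int m \<noteq> (0::'f)" by blast
      have "b = of_int n * (a / of_int m)" if "(frag_cmul n x, b) \<in> M" for n b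
      proof -
        have "of_int m * b = of_int n * a"
          using Mfun Mmult[OF that, of m] Mmult[OF ma(1), of n] by (simp add: mult.commute)
        then show ?thesis using ma(2) by (simp add: field_simps)
      qed
      then show ?thesis using that by blast
    next
      case False
      have "a = of_int m * 0" if ma: "(frag_cmul m x, a) \<in> M" for m a
      proof -
        have "of_int m = (0::'f)" using False ma by blast
        then obtain q where "m = p * q" using pdvd by blast
        then have "(frag_cmul m x, 0) \<in> M" using pM[of "frag_cmul q x"] by simp
        then show ?thesis using Mfun ma by simp
      qed
      then show ?thesis using that by blast
    qed
    define M' where "M' = {(frag_cmul m x + g, of_int m * y + a) | m g a. (g, a) \<in> M}"
    have sub: "M \<subseteq> M'"
    proof
      fix u assume "u \<in> M"
      then show "u \<in> M'" unfolding M'_def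
        by (intro CollectI exI[of _ 0] exI[of _ "fst u"] exI[of _ "snd u"]) auto
    qed
    have "M' \<in> A"
      unfolding A_def
    proof (intro CollectI conjI allI impI)
      show "\<Gamma> \<subseteq> M'" using sub \<Gamma>M by blast
    next
      fix z a w b assume "(z, a) \<in> M'" "(w, b) \<in> M'"
      then obtain m g c m' g' c' where
        "z = frag_cmul m x + g" "a = of_int m * y + c" "(g, c) \<in> M"
        "w = frag_cmul m' x + g'" "b = of_int m' * y + c'" "(g', c') \<in> M"
        unfolding M'_def by blast
      moreover from this have "(g - g', c - c') \<in> M" using Mdiff by blast
      ultimately show "(z - w, a - b) \<in> M'" unfolding M'_def
        by (intro CollectI exI[of _ "m - m'"] exI[of _ "g - g'"] exI[of _ "c - c'"])
          (auto simp: frag_cmul_diff_distrib algebra_simps)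
    next
      fix a assume "(0, a) \<in> M'"
      then obtain m g c where 1: "0 = frag_cmul m x + g" "a = of_int m * y + c" "(g, c) \<in> M"
        unfolding M'_def by blast
      have "(frag_cmul (-1) g, of_int (-1) * c) \<in> M"
        by (rule Mmult[OF 1(3)])
      moreover have "frag_cmul (-1) g = frag_cmul m x"
        using 1(1) by (metis add_eq_0_iff frag_cmul_minus_one minus_minus)
      ultimately have "- c = of_int m * y" using y by simp
      then show "a = 0" using 1(2) by (metis add.left_inverse add.commute)
    qed
    then have "M' = M" using max sub by blast
    moreover have "(x, y) \<in> M'"
      unfolding M'_def using GM[OF G0] h0
      by (intro CollectI exI[of _ 1] exI[of _ 0]) auto
    ultimately show ?thesis by blast
  qed
  \<comment> \<open>A maximal graph has full domain, so it is the graph of a function.\<close>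
  define H where "H x = (THE a. (x, a) \<in> M)" for x
  have HM: "(x, H x) \<in> M" for x
    unfolding H_def using total[of x] Mfun by (metis the_equality)
  have Hdiff: "H (x - y) = H x - H y" for x y
    using Mdiff[OF HM HM] HM Mfun by blast
  have "additive H"
  proof
    fix x y show "H (x + y) = H x + H y" using Hdiff[of "x + y" y] by simp
  qed
  moreover have "H x = h x" if "x \<in> G" for x
    using GM[OF that] HM Mfun by blast
  ultimately show ?thesis using that by blast
qed

section \<open>Field cohomology from integral homology\<close>

text \<open>
  Cochains are arbitrary functions on simplices; this is their linear extension to integral
  chains.
\<close>

definition cochain_pairing ::
  "(((nat \<Rightarrow> real) \<Rightarrow> 'a) \<Rightarrow> 'f::field) \<Rightarrow> 'a chain \<Rightarrow> 'f" where
  "cochain_pairing \<phi> c = (\<Sum>s\<in>Poly_Mapping.keys c. of_int (Poly_Mapping.lookup c s) * \<phi> s)"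

lemma cochain_pairing_superset:
  assumes "finite S" "Poly_Mapping.keys c \<subseteq> S"
  shows "cochain_pairing \<phi> c = (\<Sum>s\<in>S. of_int (Poly_Mapping.lookup c s) * \<phi> s)"
  unfolding cochain_pairing_def using assms
  by (intro sum.mono_neutral_left) (auto simp: in_keys_iff)

lemma additive_cochain_pairing: "additive (cochain_pairing \<phi>)"
proof
  fix c d :: "'a chain"
  let ?S = "Poly_Mapping.keys c \<union> Poly_Mapping.keys d"
  have "Poly_Mapping.keys (c + d) \<subseteq> ?S" by (rule keys_add)
  then show "cochain_pairing \<phi> (c + d) = cochain_pairing \<phi> c + cochain_pairing \<phi> d"
    by (simp add: cochain_pairing_superset[of ?S] lookup_add sum.distrib algebra_simps)
qed

lemma cochain_pairing_of [simp]: "cochain_pairing \<phi> (frag_of s) = \<phi> s"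
  by (simp add: cochain_pairing_def)

lemma cochain_pairing_0 [simp]: "cochain_pairing \<phi> 0 = 0"
  by (simp add: cochain_pairing_def)

lemma additive_frag_cmul:
  fixes H :: "('a \<Rightarrow>\<^sub>0 int) \<Rightarrow> 'f::ring_1"
  assumes "additive H"
  shows "H (frag_cmul m x) = of_int m * H x"
proof -
  have "(frag_cmul m x, of_int m * H x) \<in> {(x, H x) | x. True}"
    by (rule graph_int_multiple) (use additive.diff[OF assms] in auto)
  then show ?thesis by auto
qed

lemma cochain_coboundary_eq_boundary:
  assumes "additive H"
  shows "H (chain_boundary (Suc p) (frag_of s)) = cochain_coboundary p (\<lambda>t. H (frag_of t)) s"
proof -
  have "H (\<Sum>i\<le>Suc p. frag_cmul ((-1) ^ i) (frag_of (singular_face (Suc p) i s)))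
      = (\<Sum>i\<le>Suc p. H (frag_cmul ((-1) ^ i) (frag_of (singular_face (Suc p) i s))))"
    by (rule additive.sum[OF assms])
  then show ?thesis
    by (simp add: chain_boundary_of cochain_coboundary_def additive_frag_cmul[OF assms] del: sum.atMost_Suc)
qed

lemma pairing_boundary_cocycle:
  assumes "singular_cocycle p X \<phi>" "singular_chain (Suc p) X c"
  shows "cochain_pairing \<phi> (chain_boundary (Suc p) c) = 0"
  using assms(2) unfolding singular_chain_def
proof (induction c rule: frag_induction)
  case zero
  then show ?case by simp
next
  case (one s)
  have "cochain_pairing \<phi> (chain_boundary (Suc p) (frag_of s))
      = cochain_coboundary p (\<lambda>t. cochain_pairing \<phi> (frag_of t)) s"
    by (rule cochain_coboundary_eq_boundary[OF additive_cochain_pairing])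
  also have "\<dots> = 0"
    using one assms(1) by (simp add: singular_cocycle_def)
  finally show ?case .
next
  case (diff a b)
  then show ?case
    by (simp add: chain_boundary_diff additive.diff[OF additive_cochain_pairing])
qed

lemma chain_of_multiple:
  assumes "singular_chain p X (frag_cmul m c)" "m \<noteq> 0"
  shows "singular_chain p X c"
  using assms unfolding singular_chain_def by auto

lemma trivial_homology_group_cycle_boundary:
  assumes "trivial_group (homology_group (int p) X)"
    and "singular_chain p X c" "chain_boundary p c = 0"
  obtains d where "singular_chain (Suc p) X d" "chain_boundary (Suc p) d = c"
proof -
  have "homologous_rel_set p X {} c \<in> carrier (homology_group (int p) X)"
    using assms by (auto simp: carrier_relative_homology_group singular_cycle)
  then have "homologous_rel_set p X {} c = singular_relboundary_set p X {}"
    using assms(1) by (simp add: trivial_group_def)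
  then show ?thesis
    using that by (auto simp: homologous_rel_set_eq_relboundary singular_boundary)
qed

text \<open>
  In degree zero the role of the cycle condition is played by the augmentation, which is here the
  map that moves every point to the base point \<open>f\<close>.  As an equation in a torsion-free group it
  exhibits the boundaries as a pure subgroup.
\<close>

lemma zero_boundary_iff_augmentation:
  assumes X: "path_connected_space X" and f: "singular_simplex 0 X f"
  shows "(\<exists>d. singular_chain 1 X d \<and> chain_boundary 1 d = c)
    \<longleftrightarrow> singular_chain 0 X c \<and> frag_extend (\<lambda>_. frag_of f) c = 0"
proof safe
  fix d assume d: "singular_chain 1 X d"
  show "singular_chain 0 X (chain_boundary 1 d)"
    using singular_chain_boundary[OF d] by simp
  show "frag_extend (\<lambda>_. frag_of f) (chain_boundary 1 d) = 0"
    using d unfolding singular_chain_def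
  proof (induction d rule: frag_induction)
    case (one x)
    then show ?case by (simp add: frag_extend_diff chain_boundary_of)
  next
    case (diff a b)
    then show ?case by (simp add: chain_boundary_diff frag_extend_diff)
  qed simp
next
  assume c: "singular_chain 0 X c" and 0: "frag_extend (\<lambda>_. frag_of f) c = 0"
  have "homologous_rel 0 X {} c (frag_extend (\<lambda>_. frag_of f) c)"
    using c unfolding singular_chain_def
  proof (induction c rule: frag_induction)
    case (one x)
    then show ?case using iso_integer_zeroth_homology_group_aux[OF X _ f] by simp
  next
    case (diff a b)
    then show ?case by (simp add: frag_extend_diff homologous_rel_diff)
  qed simp
  then show "\<exists>d. singular_chain 1 X d \<and> chain_boundary 1 d = c"
    by (simp add: 0 homologous_rel_def singular_boundary)
qed

text \<open>
  A cocycle \<open>\<phi>\<close> of degree \<open>p + 1\<close> vanishes on boundaries, and all cycles of this degree are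
  boundaries, so \<open>\<partial>d \<mapsto> \<phi>(d)\<close> is well defined on the boundaries of degree \<open>p\<close>.  These form a
  pure subgroup: for \<open>p > 0\<close> they are the cycles, for \<open>p = 0\<close> the kernel of the augmentation.
  An extension to all chains is a cochain with coboundary \<open>\<phi>\<close>.
\<close>

theorem contractible_imp_field_acyclic:
  assumes X: "contractible_space X" "topspace X \<noteq> {}"
  shows "field_acyclic TYPE('f::field) X"
  unfolding field_acyclic_def
proof (intro conjI allI impI X(2))
  show pc: "path_connected_space X"
    using X by (simp add: contractible_imp_path_connected_space)
  fix p and \<phi> :: "((nat \<Rightarrow> real) \<Rightarrow> 'a) \<Rightarrow> 'f"
  assume cocycle: "singular_cocycle (Suc p) X \<phi>"
  have triv: "trivial_group (homology_group (int q) X)" if "q > 0" for q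
    using trivial_reduced_homology_group_contractible_space[OF X(1), of "int q"] that
    by (simp add: un_reduced_homology_group)
  define G where "G = {c. \<exists>d. singular_chain (Suc p) X d \<and> chain_boundary (Suc p) d = c}"
  define h where "h c = cochain_pairing \<phi> (SOME d. singular_chain (Suc p) X d \<and> chain_boundary (Suc p) d = c)" for c
  have h: "h (chain_boundary (Suc p) d) = cochain_pairing \<phi> d" if d: "singular_chain (Suc p) X d" for d
  proof -
    define e where "e = (SOME e. singular_chain (Suc p) X e \<and> chain_boundary (Suc p) e = chain_boundary (Suc p) d)"
    have e: "singular_chain (Suc p) X e" "chain_boundary (Suc p) e = chain_boundary (Suc p) d"
      using someI[of "\<lambda>e. singular_chain (Suc p) X e \<and> chain_boundary (Suc p) e = chain_boundary (Suc p) d" d] d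
      unfolding e_def by auto
    have "singular_chain (Suc p) X (e - d)" "chain_boundary (Suc p) (e - d) = 0"
      using e d by (auto simp: singular_chain_diff chain_boundary_diff)
    then obtain w where "singular_chain (Suc (Suc p)) X w" "chain_boundary (Suc (Suc p)) w = e - d"
      by (rule trivial_homology_group_cycle_boundary[OF triv[of "Suc p"], rotated]) auto
    then have "cochain_pairing \<phi> (e - d) = 0"
      using pairing_boundary_cocycle[OF cocycle] by metis
    then show ?thesis
      by (simp add: h_def flip: e_def) (simp add: additive.diff[OF additive_cochain_pairing])
  qed
  obtain H where H: "additive H" "\<And>c. c \<in> G \<Longrightarrow> H c = h c"
  proof (rule additive_extension_from_pure_subgroup[of G h])
    show "0 \<in> G" unfolding G_def by (intro CollectI exI[of _ 0]) auto
    fix c c' assume "c \<in> G" "c' \<in> G"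
    then obtain d d' where d: "singular_chain (Suc p) X d" "chain_boundary (Suc p) d = c"
      "singular_chain (Suc p) X d'" "chain_boundary (Suc p) d' = c'" unfolding G_def by blast
    then have dd: "singular_chain (Suc p) X (d - d')" "chain_boundary (Suc p) (d - d') = c - c'"
      by (auto simp: singular_chain_diff chain_boundary_diff)
    then show "c - c' \<in> G" unfolding G_def by blast
    show "h (c - c') = h c - h c'"
      using h d dd by (metis additive.diff[OF additive_cochain_pairing])
  next
    fix m c assume mc: "frag_cmul m c \<in> G" "m \<noteq> 0"
    then obtain d where d: "singular_chain (Suc p) X d" "chain_boundary (Suc p) d = frag_cmul m c"
      unfolding G_def by blast
    show "c \<in> G"
    proof (cases "p = 0")
      case True
      obtain a where "a \<in> topspace X" using X(2) by blast
      then have f: "singular_simplex 0 X (restrict (\<lambda>x. a) (standard_simplex 0))"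
        by (simp add: singular_simplex_def)
      show ?thesis
        using mc zero_boundary_iff_augmentation[OF pc f] chain_of_multiple[of 0 X m c]
        unfolding G_def True One_nat_def by (simp add: frag_extend_cmul)
    next
      case False
      have "singular_chain p X (frag_cmul m c)"
        using singular_chain_boundary[OF d(1)] d(2) by simp
      then have c: "singular_chain p X c" using mc(2) chain_of_multiple by blast
      have "chain_boundary p (frag_cmul m c) = 0"
        using chain_boundary_boundary_alt[OF d(1)] d(2) by simp
      then have "chain_boundary p c = 0" using mc(2) by (simp add: chain_boundary_cmul)
      then show ?thesis
        using trivial_homology_group_cycle_boundary[OF triv[of p] c] False unfolding G_def by blast
    qed
  qed blast
  show "singular_coboundary_Suc p X \<phi>"
    unfolding singular_coboundary_Suc_def
  proof (intro exI allI impI)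
    fix s assume "singular_simplex (Suc p) X s"
    then have s: "singular_chain (Suc p) X (frag_of s)" by (simp add: singular_chain_of)
    then have "H (chain_boundary (Suc p) (frag_of s)) = \<phi> s"
      using H(2) h unfolding G_def by fastforce
    then show "\<phi> s = cochain_coboundary p (\<lambda>t. H (frag_of t)) s"
      by (simp add: cochain_coboundary_eq_boundary[OF H(1)])
  qed
qed

lemma homology_class_add:
  assumes "singular_relcycle p X S a" "singular_relcycle p X S b"
  shows "homologous_rel_set p X S (a + b)
    = homologous_rel_set p X S a \<otimes>\<^bsub>relative_homology_group (int p) X S\<^esub> homologous_rel_set p X S b"
proof -
  have "\<exists>r s. homologous_rel p X S a r \<and> homologous_rel p X S b s \<and> x = r + s"
    if "homologous_rel p X S (a + b) x" for x
    using that by (intro exI[of _ "a"] exI[of _ "x - a"])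
      (auto simp: homologous_rel_def algebra_simps)
  then show ?thesis
    by (auto simp: mult_relative_homology_group homologous_rel_add)
qed

lemma not_path_connected_0_sphere: "\<not> path_connected_space (nsphere 0)"
proof
  assume "path_connected_space (nsphere 0)"
  then have "connectedin euclideanreal ((\<lambda>x. x 0) ` topspace (nsphere 0))"
    using continuous_map_nsphere_projection
    by (meson connectedin_continuous_map_image connectedin_topspace path_connected_imp_connected_space)
  moreover have "(\<lambda>x. x 0) ` topspace (nsphere 0) = {1, -1::real}"
  proof -
    have "topspace (nsphere 0) = {x. (x 0)\<^sup>2 = 1 \<and> (\<forall>i>0. x i = (0::real))}"
      by (simp add: nsphere)
    moreover have "y \<in> (\<lambda>x. x (0::nat)) ` {x. (x 0)\<^sup>2 = 1 \<and> (\<forall>i>0. x i = (0::real))}" if "y \<in> {1, -1}" for y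
      using that by (intro image_eqI[of _ _ "\<lambda>i::nat. if i = 0 then y else 0"]) auto
    ultimately show ?thesis
      by (auto simp: power2_eq_1_iff)
  qed
  ultimately have "connected {1, -1::real}" by simp
  then show False
    using connected_contains_Icc[of "{1, -1::real}" "-1" 1] by (auto simp: subset_iff dest: spec[of _ 0])
qed

text \<open>
  In positive degree \<open>n\<close> pull the fundamental class back along the retraction: a cycle of \<open>X\<close> is
  pushed to the sphere, read as an integer in \<open>H\<^sub>n\<close> of the sphere, and mapped to the field.
  Extended to all chains this is a cocycle, and its value on the image of the fundamental cycle
  is \<open>1\<close>, whereas every coboundary vanishes on cycles.  For \<open>n = 0\<close> path connectedness fails.
\<close>

theorem sphere_retract_not_field_acyclic:
  fixes X :: "'a topology"
  assumes f: "continuous_map (nsphere n) X f" and r: "continuous_map X (nsphere n) r"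
    and rf: "\<And>u. u \<in> topspace (nsphere n) \<Longrightarrow> r (f u) = u"
  shows "\<not> field_acyclic TYPE('f::field) X"
proof
  assume acyc: "field_acyclic TYPE('f) X"
  let ?S = "nsphere n"
  show False
  proof (cases n)
    case 0
    have "r ` topspace X = topspace ?S"
      using f r rf by (force simp: continuous_map_def Pi_iff image_iff)
    moreover have "path_connected_space X" using acyc by (simp add: field_acyclic_def)
    ultimately have "path_connected_space ?S"
      using path_connectedin_continuous_map_image[OF r, of "topspace X"]
      by (simp add: path_connectedin_topspace)
    then show False using not_path_connected_0_sphere 0 by simp
  next
    case (Suc p)
    let ?HS = "homology_group (int n) ?S"
    have "reduced_homology_group (int n) ?S = ?HS"
      using Suc by (intro un_reduced_homology_group) simp
    then obtain \<alpha> where \<alpha>: "\<alpha> \<in> iso ?HS integer_group"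
      using reduced_homology_group_nsphere(1)[of n] by (auto simp: is_iso_def)
    then have "1 \<in> \<alpha> ` carrier ?HS"
      by (simp add: iso_def bij_betw_def)
    then obtain z where z: "singular_relcycle n ?S {} z"
        and \<alpha>z: "\<alpha> (homologous_rel_set n ?S {} z) = 1"
      by (auto simp: carrier_relative_homology_group)
    have \<alpha>add: "\<alpha> (homologous_rel_set n ?S {} (a + b))
        = \<alpha> (homologous_rel_set n ?S {} a) + \<alpha> (homologous_rel_set n ?S {} b)"
      if "singular_relcycle n ?S {} a" "singular_relcycle n ?S {} b" for a b
    proof -
      have "\<alpha> \<in> hom ?HS integer_group" using \<alpha> by (simp add: iso_def)
      then show ?thesis
        using that hom_mult[of \<alpha> ?HS integer_group] homology_class_add[OF that]
        by (simp add: carrier_relative_homology_group)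
    qed
    define G where "G = {c. singular_relcycle n X {} c}"
    define h :: "'a chain \<Rightarrow> 'f" where
      "h c = of_int (\<alpha> (homologous_rel_set n ?S {} (chain_map n r c)))" for c
    have rc: "singular_relcycle n ?S {} (chain_map n r c)" if "c \<in> G" for c
      using singular_relcycle_chain_map[of n X "{}" c ?S r "{}"] that r by (auto simp: G_def)
    have Gdiff: "c - d \<in> G" if "c \<in> G" "d \<in> G" for c d
      using that by (simp add: G_def singular_relcycle_diff)
    obtain H where H: "additive H" "\<And>c. c \<in> G \<Longrightarrow> H c = h c"
    proof (rule additive_extension_from_pure_subgroup[of G h])
      show "0 \<in> G" by (simp add: G_def)
      fix c d assume cd: "c \<in> G" "d \<in> G"
      then show "c - d \<in> G" by (rule Gdiff)
      have "h ((c - d) + d) = h (c - d) + h d"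
        unfolding h_def chain_map_add
        by (subst \<alpha>add) (use cd Gdiff rc in auto)
      then show "h (c - d) = h c - h d" by (simp add: algebra_simps)
    next
      fix m c assume "frag_cmul m c \<in> G" "m \<noteq> 0"
      then show "c \<in> G"
        unfolding G_def using chain_of_multiple by (auto simp: singular_cycle chain_boundary_cmul)
    qed blast
    have cocycle: "singular_cocycle (Suc p) X (\<lambda>s. H (frag_of s))"
      unfolding singular_cocycle_def
    proof (intro allI impI)
      fix s assume "singular_simplex (Suc (Suc p)) X s"
      then have "singular_chain (Suc n) X (frag_of s)"
        using Suc by (simp add: singular_chain_of)
      then have "singular_relboundary n X {} (chain_boundary (Suc n) (frag_of s))"
        unfolding singular_boundary by blast
      then have "chain_boundary (Suc n) (frag_of s) \<in> G"
        and b: "singular_relboundary n ?S {} (chain_map n r (chain_boundary (Suc n) (frag_of s)))"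
        using singular_relboundary_imp_relcycle singular_relboundary_chain_map[of n X "{}" _ ?S r "{}"] r
        by (auto simp: G_def)
      then have "H (chain_boundary (Suc n) (frag_of s))
          = of_int (\<alpha> (homologous_rel_set n ?S {} (chain_map n r (chain_boundary (Suc n) (frag_of s)))))"
        by (simp add: H h_def)
      also have "homologous_rel_set n ?S {} (chain_map n r (chain_boundary (Suc n) (frag_of s)))
          = homologous_rel_set n ?S {} 0"
        using b unfolding homologous_rel_set_eq by (simp add: homologous_rel_def)
      also have "\<alpha> \<dots> = 0" using \<alpha>add[of 0 0] by simp
      finally show "cochain_coboundary (Suc p) (\<lambda>s. H (frag_of s)) s = 0"
        using cochain_coboundary_eq_boundary[OF H(1), of n s] Suc by simp
    qed
    then obtain \<psi> where \<psi>: "\<And>s. singular_simplex (Suc p) X s \<Longrightarrow> H (frag_of s) = cochain_coboundary p \<psi> s"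
      using acyc by (fastforce simp: field_acyclic_def singular_coboundary_Suc_def)
    have eq: "H c = cochain_pairing \<psi> (chain_boundary n c)" if "singular_chain n X c" for c
      using that unfolding singular_chain_def
    proof (induction c rule: frag_induction)
      case zero
      then show ?case using additive.zero[OF H(1)] by simp
    next
      case (one s)
      then show ?case
        using \<psi> cochain_coboundary_eq_boundary[OF additive_cochain_pairing, of \<psi> p s] Suc by simp
    next
      case (diff a b)
      then show ?case
        by (simp add: additive.diff[OF H(1)] chain_boundary_diff additive.diff[OF additive_cochain_pairing])
    qed
    define w where "w = chain_map n f z"
    have w: "singular_relcycle n X {} w"
      using singular_relcycle_chain_map[OF z f] by (simp add: w_def)
    have "chain_map n r w = chain_map n (r \<circ> f) z"
      by (simp add: w_def chain_map_compose)
    also have "\<dots> = z"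
      using z rf by (intro chain_map_id_gen[of n ?S]) (auto simp: singular_cycle)
    finally have "H w = 1"
      using w H(2)[of w] \<alpha>z by (simp add: G_def h_def)
    moreover have "H w = 0"
      using eq[of w] w by (simp add: singular_cycle)
    ultimately show False by simp
  qed
qed

section \<open>Normal forms in the quotient space\<close>

text \<open>
  Rays are pairs, but statements about all rays are better kept in one quantifier.
\<close>

declare split_paired_All [simp del] split_paired_Ex [simp del]

text \<open>
  Stated as an infimum because infima of finitely many continuous functions are known to be
  continuous.
\<close>

definition block_min :: "(nat \<Rightarrow> nat) \<Rightarrow> (nat \<times> nat \<Rightarrow> real) \<Rightarrow> nat \<Rightarrow> real" where
  "block_min ell x j = (INF \<nu>\<in>{1..ell j}. x (j, \<nu>))"

lemma block_min_le: "\<nu> \<in> {1..ell j} \<Longrightarrow> block_min ell x j \<le> x (j, \<nu>)"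
  unfolding block_min_def by (rule cINF_lower) auto

lemma block_min_attained:
  assumes "ell j \<ge> 1" shows "\<exists>\<nu>\<in>{1..ell j}. x (j, \<nu>) = block_min ell x j"
proof -
  have "block_min ell x j \<in> (\<lambda>\<nu>. x (j, \<nu>)) ` {1..ell j}"
    unfolding block_min_def using assms by (subst cInf_eq_Min) (auto intro!: Min_in)
  then show ?thesis by auto
qed

lemma block_min_eqI:
  assumes "\<nu> \<in> {1..ell j}" "x (j, \<nu>) = m" "\<And>\<nu>. \<nu> \<in> {1..ell j} \<Longrightarrow> m \<le> x (j, \<nu>)"
  shows "block_min ell x j = m"
proof -
  have "1 \<le> ell j" using assms(1) by simp
  then obtain \<kappa> where "\<kappa> \<in> {1..ell j}" "x (j, \<kappa>) = block_min ell x j"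
    using block_min_attained[of ell j x] by blast
  then show ?thesis
    using assms(2) assms(3)[of \<kappa>] block_min_le[of \<nu> ell j x] assms(1) by simp
qed

lemma block_min_add_const:
  assumes "ell j \<ge> 1" "\<And>\<nu>. \<nu> \<in> {1..ell j} \<Longrightarrow> y (j, \<nu>) = x (j, \<nu>) + t"
  shows "block_min ell y j = block_min ell x j + t"
proof -
  obtain \<nu> where "\<nu> \<in> {1..ell j}" "x (j, \<nu>) = block_min ell x j"
    using block_min_attained[of ell j x] assms(1) by blast
  then show ?thesis
    using assms(2) block_min_le[of _ ell j x] by (intro block_min_eqI[of \<nu>]) auto
qed

lemma continuous_map_block_min:
  assumes "\<And>\<nu>. continuous_map X euclideanreal (\<lambda>u. f u (j, \<nu>))"
  shows "continuous_map X euclideanreal (\<lambda>u. block_min ell (f u) j)"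
  unfolding block_min_def by (intro continuous_map_Inf assms) auto

definition row_vec ::
  "nat \<Rightarrow> (nat \<Rightarrow> nat) \<Rightarrow> (nat \<Rightarrow> nat \<Rightarrow> nat \<Rightarrow> int) \<Rightarrow> (nat \<Rightarrow> real) \<Rightarrow> nat \<times> nat \<Rightarrow> real" where
  "row_vec k ell c lam r =
     (if r \<in> ray_index k ell then (\<Sum>i=1..k. lam i * of_int (pi_entry c i r)) else 0)"

lemma row_span_eq: "row_span k ell c = range (row_vec k ell c)"
  by (auto simp: row_span_def row_vec_def fun_eq_iff)

lemma row_vec_entry:
  assumes "(j, \<nu>) \<in> ray_index k ell"
  shows "row_vec k ell c lam (j, \<nu>) = lam j + (\<Sum>i\<in>{1..<j}. lam i * of_int (c i j \<nu>))"
proof -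
  have j: "j \<in> {1..k}" using assms by (simp add: ray_index_def)
  have "row_vec k ell c lam (j, \<nu>) = (\<Sum>i=1..k. lam i * of_int (pi_entry c i (j, \<nu>)))"
    using assms by (simp add: row_vec_def)
  also have "\<dots> = (\<Sum>i\<in>insert j {1..<j}. lam i * of_int (pi_entry c i (j, \<nu>)))"
    using j by (intro sum.mono_neutral_right) (auto simp: pi_entry_def)
  also have "\<dots> = lam j + (\<Sum>i\<in>{1..<j}. lam i * of_int (c i j \<nu>))"
    by (simp add: pi_entry_def)
  finally show ?thesis .
qed

lemma row_vec_cong:
  "(\<And>i. i \<in> {1..k} \<Longrightarrow> lam i = mu i) \<Longrightarrow> row_vec k ell c lam = row_vec k ell c mu"
  by (auto simp: row_vec_def fun_eq_iff)

lemma row_vec_diff: "row_vec k ell c (\<lambda>i. lam i - mu i) r = row_vec k ell c lam r - row_vec k ell c mu r"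
  by (simp add: row_vec_def sum_subtractf algebra_simps)

lemma row_vec_scale: "row_vec k ell c (\<lambda>i. t * lam i) r = t * row_vec k ell c lam r"
  by (simp add: row_vec_def sum_distrib_left mult.assoc)

lemma row_vec_0 [simp]: "row_vec k ell c (\<lambda>i. 0) r = 0"
  by (simp add: row_vec_def)

lemma N_proj_eq: "N_proj k ell c x = range (\<lambda>lam r. x r + row_vec k ell c lam r)"
  by (auto simp: N_proj_def row_span_eq)

lemma N_proj_eqD:
  assumes "N_proj k ell c x = N_proj k ell c y"
  obtains lam where "y = (\<lambda>r. x r + row_vec k ell c lam r)"
proof -
  have "y \<in> N_proj k ell c y"
    unfolding N_proj_eq by (rule range_eqI[of _ _ "\<lambda>_. 0"]) simp
  then show ?thesis using that assms unfolding N_proj_eq by blast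
qed

lemma N_scale_N_proj:
  assumes "t \<noteq> 0"
  shows "N_scale t (N_proj k ell c x) = N_proj k ell c (\<lambda>r. t * x r)"
proof -
  have scale: "(\<lambda>r. t * (x r + row_vec k ell c lam r)) = (\<lambda>r. t * x r + row_vec k ell c (\<lambda>i. t * lam i) r)" for lam
    by (simp add: row_vec_scale algebra_simps)
  have "N_scale t (N_proj k ell c x) = range (\<lambda>lam r. t * x r + row_vec k ell c (\<lambda>i. t * lam i) r)"
    unfolding N_proj_eq N_scale_def image_image scale ..
  also have "\<dots> = (\<lambda>lam r. t * x r + row_vec k ell c lam r) ` range (\<lambda>lam i. t * lam i)"
    by (simp add: image_image)
  also have "range (\<lambda>lam i. t * lam i) = (UNIV :: (nat \<Rightarrow> real) set)"
  proof (rule surjI[of _ "\<lambda>lam i. lam i / t"])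
    show "(\<lambda>i. t * (lam i / t)) = lam" for lam :: "nat \<Rightarrow> real" using assms by simp
  qed
  finally show ?thesis unfolding N_proj_eq .
qed

text \<open>
  The coefficients of the combination of rows that brings every block minimum to zero.  Row \<open>j\<close>
  is constantly one on block \<open>j\<close> and zero on earlier blocks, so the \<open>j\<close>-th coefficient is forced
  once the earlier rows have been added.
\<close>

fun normalizer ::
  "(nat \<Rightarrow> nat) \<Rightarrow> (nat \<Rightarrow> nat \<Rightarrow> nat \<Rightarrow> int) \<Rightarrow> (nat \<times> nat \<Rightarrow> real) \<Rightarrow> nat \<Rightarrow> real" where
  "normalizer ell c x j =
     - (INF \<nu>\<in>{1..ell j}. x (j, \<nu>) + (\<Sum>i\<in>{1..<j}. normalizer ell c x i * of_int (c i j \<nu>)))"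

declare normalizer.simps [simp del]

definition normal_form ::
  "nat \<Rightarrow> (nat \<Rightarrow> nat) \<Rightarrow> (nat \<Rightarrow> nat \<Rightarrow> nat \<Rightarrow> int) \<Rightarrow> (nat \<times> nat \<Rightarrow> real) \<Rightarrow> nat \<times> nat \<Rightarrow> real" where
  "normal_form k ell c x r = x r + row_vec k ell c (normalizer ell c x) r"

definition block_reduced :: "nat \<Rightarrow> (nat \<Rightarrow> nat) \<Rightarrow> (nat \<times> nat \<Rightarrow> real) set" where
  "block_reduced k ell = {x \<in> Rrays k ell. \<forall>j\<in>{1..k}. block_min ell x j = 0}"

lemma normalizer_block_min:
  "normalizer ell c x j
    = - block_min ell (\<lambda>r. x r + (\<Sum>i\<in>{1..<j}. normalizer ell c x i * of_int (c i j (snd r)))) j"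
  by (subst normalizer.simps) (simp add: block_min_def)

text \<open>
  The recursion undoes any combination of rows that was added beforehand; this is what makes the
  normal form an invariant of the coset.
\<close>

lemma normalizer_add_row:
  assumes ell: "\<forall>j\<in>{1..k}. ell j \<ge> 1" and j: "j \<in> {1..k}"
  shows "normalizer ell c (\<lambda>r. x r + row_vec k ell c lam r) j = normalizer ell c x j - lam j"
  using j
proof (induction j rule: less_induct)
  case (less j)
  let ?x = "\<lambda>r. x r + row_vec k ell c lam r"
  let ?f = "\<lambda>x r. x r + (\<Sum>i\<in>{1..<j}. normalizer ell c x i * of_int (c i j (snd r)))"
  have "block_min ell (?f ?x) j = block_min ell (?f x) j + lam j"
  proof (rule block_min_add_const)
    show "1 \<le> ell j" using ell less.prems by blast
    fix \<nu> assume "\<nu> \<in> {1..ell j}"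
    then have r: "(j, \<nu>) \<in> ray_index k ell" using less.prems by (simp add: ray_index_def)
    have "(\<Sum>i\<in>{1..<j}. normalizer ell c ?x i * of_int (c i j \<nu>))
        = (\<Sum>i\<in>{1..<j}. normalizer ell c x i * of_int (c i j \<nu>)) - (\<Sum>i\<in>{1..<j}. lam i * of_int (c i j \<nu>))"
      unfolding sum_subtractf[symmetric] using less.prems
      by (intro sum.cong refl, subst less.IH) (auto simp: left_diff_distrib)
    then show "?f ?x (j, \<nu>) = ?f x (j, \<nu>) + lam j"
      by (simp add: row_vec_entry[OF r])
  qed
  then show ?case
    by (simp add: normalizer_block_min[of ell c _ j])
qed

lemma normal_form_add_row:
  assumes "\<forall>j\<in>{1..k}. ell j \<ge> 1"
  shows "normal_form k ell c (\<lambda>r. x r + row_vec k ell c lam r) = normal_form k ell c x"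
proof -
  have "row_vec k ell c (normalizer ell c (\<lambda>r. x r + row_vec k ell c lam r))
      = row_vec k ell c (\<lambda>i. normalizer ell c x i - lam i)"
    using normalizer_add_row[OF assms] by (rule row_vec_cong)
  then show ?thesis
    by (auto simp: normal_form_def row_vec_diff)
qed

lemma normal_form_of_reduced:
  assumes "x \<in> block_reduced k ell"
  shows "normal_form k ell c x = x"
proof -
  have "normalizer ell c x j = 0" if "j \<in> {1..k}" for j
    using that
  proof (induction j rule: less_induct)
    case (less j)
    then have "(\<lambda>r. x r + (\<Sum>i\<in>{1..<j}. normalizer ell c x i * of_int (c i j (snd r)))) = x"
      by (intro ext) (simp add: sum.neutral)
    then show ?case
      using assms less.prems by (simp add: normalizer_block_min[of ell c x j] block_reduced_def)
  qed
  then have "row_vec k ell c (normalizer ell c x) = row_vec k ell c (\<lambda>_. 0)"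
    by (rule row_vec_cong)
  then show ?thesis by (auto simp: normal_form_def)
qed

lemma N_proj_inj_on_reduced:
  assumes "\<forall>j\<in>{1..k}. ell j \<ge> 1"
  shows "inj_on (N_proj k ell c) (block_reduced k ell)"
proof
  fix x y assume x: "x \<in> block_reduced k ell" and y: "y \<in> block_reduced k ell"
    and "N_proj k ell c x = N_proj k ell c y"
  then obtain lam where "y = (\<lambda>r. x r + row_vec k ell c lam r)" by (elim N_proj_eqD)
  then show "x = y"
    using normal_form_add_row[OF assms] normal_form_of_reduced[OF x] normal_form_of_reduced[OF y] by metis
qed

lemma continuous_map_normal_form:
  "continuous_map (powertop_real UNIV) (powertop_real UNIV) (normal_form k ell c)"
proof -
  let ?E = "powertop_real (UNIV :: (nat \<times> nat) set)"
  have proj: "continuous_map ?E euclideanreal (\<lambda>x. x r)" for r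
    by (rule continuous_map_product_projection) simp
  have norm: "continuous_map ?E euclideanreal (\<lambda>x. normalizer ell c x j)" for j
  proof (induction j rule: less_induct)
    case (less j)
    show ?case
      unfolding normalizer_block_min[of ell c _ j]
      by (intro continuous_map_minus continuous_map_block_min continuous_map_add proj
          continuous_map_sum continuous_map_real_mult_right) (auto intro: less)
  qed
  have "continuous_map ?E euclideanreal (\<lambda>x. normal_form k ell c x r)" for r
    unfolding normal_form_def row_vec_def
    by (cases "r \<in> ray_index k ell") (auto intro!: continuous_map_add proj
          continuous_map_sum continuous_map_real_mult_right norm)
  then show ?thesis
    by (simp add: continuous_map_componentwise_UNIV)
qed

lemma topspace_N_top: "topspace (N_top k ell c) = N_space k ell c"
proof -
  have "openin (N_top k ell c) (N_space k ell c)"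
  proof -
    have "{x \<in> Rrays k ell. N_proj k ell c x \<in> N_space k ell c} = Rrays k ell"
      by (auto simp: N_space_def)
    then show ?thesis
      unfolding openin_N_top by (simp add: openin_subtopology_refl)
  qed
  then show ?thesis
    using openin_subset[of "N_top k ell c"] openin_topspace[of "N_top k ell c"]
    unfolding openin_N_top by blast
qed

lemma quotient_map_N_proj:
  "quotient_map (subtopology (powertop_real UNIV) (Rrays k ell)) (N_top k ell c) (N_proj k ell c)"
  unfolding quotient_map_def topspace_N_top
proof (intro conjI allI impI)
  show "N_proj k ell c ` topspace (subtopology (powertop_real UNIV) (Rrays k ell)) = N_space k ell c"
    by (simp add: N_space_def)
qed (simp add: openin_N_top)


section \<open>The space of a set of rays in normal-form coordinates\<close>

definition reduced_supported :: "nat \<Rightarrow> (nat \<Rightarrow> nat) \<Rightarrow> (nat \<times> nat) set \<Rightarrow> (nat \<times> nat \<Rightarrow> real) set" where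
  "reduced_supported k ell R = {x \<in> block_reduced k ell. (\<forall>r. r \<notin> R \<longrightarrow> x r = 0) \<and> (\<exists>r. x r \<noteq> 0)}"

lemma block_reduced_iff:
  assumes "\<forall>j\<in>{1..k}. ell j \<ge> 1"
  shows "x \<in> block_reduced k ell \<longleftrightarrow> x \<in> Rrays k ell \<and>
    (\<forall>j\<in>{1..k}. (\<forall>\<nu>\<in>{1..ell j}. 0 \<le> x (j, \<nu>)) \<and> (\<exists>\<nu>\<in>{1..ell j}. x (j, \<nu>) = 0))"
proof -
  have "block_min ell x j = 0 \<longleftrightarrow> (\<forall>\<nu>\<in>{1..ell j}. 0 \<le> x (j, \<nu>)) \<and> (\<exists>\<nu>\<in>{1..ell j}. x (j, \<nu>) = 0)"
    if "j \<in> {1..k}" for j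
  proof
    assume "block_min ell x j = 0"
    then show "(\<forall>\<nu>\<in>{1..ell j}. 0 \<le> x (j, \<nu>)) \<and> (\<exists>\<nu>\<in>{1..ell j}. x (j, \<nu>) = 0)"
      using block_min_le[of _ ell j x] block_min_attained[of ell j x] assms that by metis
  qed (auto intro: block_min_eqI)
  then show ?thesis by (auto simp: block_reduced_def)
qed

lemma reduced_nonneg:
  assumes "\<forall>j\<in>{1..k}. ell j \<ge> 1" "x \<in> block_reduced k ell"
  shows "0 \<le> x r"
proof (cases "r \<in> ray_index k ell")
  case True
  then show ?thesis using assms by (cases r) (auto simp: block_reduced_iff ray_index_def)
next
  case False
  then show ?thesis using assms(2) unfolding block_reduced_def Rrays_def by auto
qed

text \<open>
  The sets of rays that span a cone of the fan.
\<close>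

definition face :: "nat \<Rightarrow> (nat \<Rightarrow> nat) \<Rightarrow> (nat \<times> nat) set \<Rightarrow> bool" where
  "face k ell S \<longleftrightarrow> S \<subseteq> ray_index k ell \<and> (\<forall>j\<in>{1..k}. \<not> {j} \<times> {1..ell j} \<subseteq> S)"

lemma supported_on_face_reduced:
  assumes ell: "\<forall>j\<in>{1..k}. ell j \<ge> 1" and S: "face k ell S"
    and x: "\<forall>r. r \<notin> S \<longrightarrow> x r = 0" "\<forall>r\<in>S. 0 \<le> x r"
  shows "x \<in> block_reduced k ell"
proof -
  have "0 \<le> x r" for r using x by (metis order_refl)
  moreover have "\<exists>\<nu>\<in>{1..ell j}. x (j, \<nu>) = 0" if "j \<in> {1..k}" for j
  proof -
    have "\<not> {j} \<times> {1..ell j} \<subseteq> S" using S that by (simp add: face_def)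
    then obtain \<nu> where "\<nu> \<in> {1..ell j}" "(j, \<nu>) \<notin> S" by blast
    then show ?thesis using x(1) by blast
  qed
  ultimately show ?thesis
    using S x(1) by (auto simp: block_reduced_iff[OF ell] Rrays_def face_def)
qed

lemma reduced_support_face:
  assumes ell: "\<forall>j\<in>{1..k}. ell j \<ge> 1" and x: "x \<in> block_reduced k ell"
  shows "face k ell {r. x r \<noteq> 0}"
  using x unfolding block_reduced_iff[OF ell] face_def Rrays_def by blast

text \<open>
  A ray generator is block-reduced because every block has at least two rays, and so are the
  vectors that define the cone over \<open>S\<close>.  Uniqueness of block-reduced representatives therefore
  shows that the cone over \<open>S\<close> contains no generators besides those in \<open>S\<close>.
\<close>

lemma cone_rays_N_cone:
  assumes ell: "\<forall>j\<in>{1..k}. ell j \<ge> 2" and S: "face k ell S"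
  shows "cone_rays k ell c (N_cone k ell c S) = S"
proof
  have ell1: "\<forall>j\<in>{1..k}. ell j \<ge> 1" using ell by auto
  show "cone_rays k ell c (N_cone k ell c S) \<subseteq> S"
  proof
    fix r assume "r \<in> cone_rays k ell c (N_cone k ell c S)"
    then obtain x where r: "r \<in> ray_index k ell" and x: "\<forall>r. r \<notin> S \<longrightarrow> x r = 0" "\<forall>r\<in>S. 0 \<le> x r"
      and eq: "N_proj k ell c (\<lambda>s. if s = r then 1 else 0) = N_proj k ell c x"
      by (auto simp: cone_rays_def N_cone_def ray_gen_def)
    have "face k ell {r}"
      unfolding face_def
    proof (intro conjI ballI notI)
      fix j assume j: "j \<in> {1..k}" and sub: "{j} \<times> {1..ell j} \<subseteq> {r}"
      have "(j, 1) \<in> {j} \<times> {1..ell j}" "(j, 2) \<in> {j} \<times> {1..ell j}" using ell j by force+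
      then have "(j, 1::nat) = (j, 2)" using sub by blast
      then show False by simp
    qed (use r in simp)
    then have "(\<lambda>s. if s = r then 1 else 0) \<in> block_reduced k ell"
      by (intro supported_on_face_reduced[OF ell1]) auto
    moreover have "x \<in> block_reduced k ell" by (rule supported_on_face_reduced[OF ell1 S x])
    ultimately have "x = (\<lambda>s. if s = r then 1 else 0)"
      using N_proj_inj_on_reduced[OF ell1, of c] eq by (auto dest: inj_onD)
    then have "x r = 1" by simp
    then show "r \<in> S" using x(1) by (metis zero_neq_one)
  qed
  show "S \<subseteq> cone_rays k ell c (N_cone k ell c S)"
  proof
    fix r assume r: "r \<in> S"
    then have "ray_gen k ell c r \<in> N_cone k ell c S"
      unfolding ray_gen_def N_cone_def by (intro imageI) auto
    then show "r \<in> cone_rays k ell c (N_cone k ell c S)"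
      using r S by (auto simp: cone_rays_def face_def)
  qed
qed

text \<open>
  The support of a block-reduced vector contains no full block, so it spans a cone; dividing by
  the sum of the coordinates moves the vector into the convex hull of its generators.
\<close>

lemma V_gt_eq_image:
  assumes ell: "\<forall>j\<in>{1..k}. ell j \<ge> 2"
  shows "V_gt k ell c R = N_proj k ell c ` reduced_supported k ell R"
proof -
  have ell1: "\<forall>j\<in>{1..k}. ell j \<ge> 1" using ell by auto
  have V: "V_gt k ell c R =
      {N_scale t \<xi> | t \<xi>. t > 0 \<and> \<xi> \<in> (\<Union>S\<in>{S. face k ell S}. N_conv k ell c (R \<inter> S))}"
  proof -
    have "splitting_fan k ell c = N_cone k ell c ` {S. face k ell S}"
      by (simp add: splitting_fan_def face_def)
    then have "(\<Union>\<sigma>\<in>splitting_fan k ell c. N_conv k ell c (R \<inter> cone_rays k ell c \<sigma>))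
        = (\<Union>S\<in>{S. face k ell S}. N_conv k ell c (R \<inter> S))"
      using cone_rays_N_cone[OF ell] by auto
    then show ?thesis unfolding V_gt_def by simp
  qed
  show ?thesis
  proof
    show "V_gt k ell c R \<subseteq> N_proj k ell c ` reduced_supported k ell R"
    proof
      fix \<xi> assume "\<xi> \<in> V_gt k ell c R"
      then obtain t x S where t: "t > 0" and S: "face k ell S" and \<xi>: "\<xi> = N_scale t (N_proj k ell c x)"
        and x: "\<forall>r. r \<notin> R \<inter> S \<longrightarrow> x r = 0" "\<forall>r\<in>R \<inter> S. 0 \<le> x r" "(\<Sum>r\<in>R \<inter> S. x r) = 1"
        unfolding V N_conv_def by auto
      have "\<exists>r. x r \<noteq> 0" using x(3) by (metis sum.neutral zero_neq_one)
      moreover have "(\<lambda>r. t * x r) \<in> block_reduced k ell"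
      proof (intro supported_on_face_reduced[OF ell1 S] allI impI ballI)
        show "t * x r = 0" if "r \<notin> S" for r using x(1) that by simp
        show "0 \<le> t * x r" for r using x(1,2) t by (metis mult_nonneg_nonneg order_less_imp_le order_refl)
      qed
      ultimately have "(\<lambda>r. t * x r) \<in> reduced_supported k ell R"
        using x t by (auto simp: reduced_supported_def)
      then show "\<xi> \<in> N_proj k ell c ` reduced_supported k ell R"
        using \<xi> t by (simp add: N_scale_N_proj)
    qed
    show "N_proj k ell c ` reduced_supported k ell R \<subseteq> V_gt k ell c R"
    proof
      fix \<xi> assume "\<xi> \<in> N_proj k ell c ` reduced_supported k ell R"
      then obtain x where x: "x \<in> block_reduced k ell" "\<forall>r. r \<notin> R \<longrightarrow> x r = 0" "\<exists>r. x r \<noteq> 0"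
        and \<xi>: "\<xi> = N_proj k ell c x" by (auto simp: reduced_supported_def)
      define S where "S = {r. x r \<noteq> 0}"
      have S: "face k ell S" unfolding S_def by (rule reduced_support_face[OF ell1 x(1)])
      have RS: "R \<inter> S = S" using x(2) by (auto simp: S_def)
      have "finite (ray_index k ell)" by (simp add: ray_index_def)
      then have "finite S" using S finite_subset by (auto simp: face_def)
      define t where "t = (\<Sum>r\<in>S. x r)"
      have pos: "t > 0"
        unfolding t_def using x(3) reduced_nonneg[OF ell1 x(1)] \<open>finite S\<close>
        by (intro sum_pos) (auto simp: S_def less_le)
      have "\<xi> = N_scale t (N_proj k ell c (\<lambda>r. x r / t))"
        using pos by (simp add: N_scale_N_proj \<xi>)
      moreover have "N_proj k ell c (\<lambda>r. x r / t) \<in> N_conv k ell c (R \<inter> S)"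
        unfolding N_conv_def RS
      proof (intro imageI CollectI conjI allI impI ballI)
        show "x r / t = 0" if "r \<notin> S" for r using that by (simp add: S_def)
        show "0 \<le> x r / t" for r using reduced_nonneg[OF ell1 x(1)] pos by simp
        show "(\<Sum>r\<in>S. x r / t) = 1" using pos by (simp add: t_def flip: sum_divide_distrib)
      qed
      ultimately show "\<xi> \<in> V_gt k ell c R" unfolding V using pos S by blast
    qed
  qed
qed

text \<open>
  The normal form is constant on cosets, so it descends to a continuous map on the quotient, and
  this map inverts the projection on block-reduced vectors.
\<close>

theorem V_gt_homeomorphic:
  assumes ell: "\<forall>j\<in>{1..k}. ell j \<ge> 2"
  shows "subtopology (powertop_real UNIV) (reduced_supported k ell R)
    homeomorphic_space subtopology (N_top k ell c) (V_gt k ell c R)"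
proof -
  have ell1: "\<forall>j\<in>{1..k}. ell j \<ge> 1" using ell by auto
  let ?E = "powertop_real (UNIV :: (nat \<times> nat) set)"
  let ?W = "reduced_supported k ell R"
  obtain g where g: "continuous_map (N_top k ell c) ?E g"
    and gN: "\<And>x. x \<in> Rrays k ell \<Longrightarrow> g (N_proj k ell c x) = normal_form k ell c x"
  proof (rule quotient_map_lift_exists[OF quotient_map_N_proj])
    show "continuous_map (subtopology ?E (Rrays k ell)) ?E (normal_form k ell c)"
      by (rule continuous_map_from_subtopology[OF continuous_map_normal_form])
    show "normal_form k ell c x = normal_form k ell c y" if "N_proj k ell c x = N_proj k ell c y" for x y
      using that N_proj_eqD normal_form_add_row[OF ell1] by metis
  qed auto
  have sub: "?W \<subseteq> Rrays k ell" by (auto simp: reduced_supported_def block_reduced_def)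
  have gW: "g (N_proj k ell c x) = x" if "x \<in> ?W" for x
    using that sub gN normal_form_of_reduced by (auto simp: reduced_supported_def)
  have "homeomorphic_maps (subtopology ?E ?W) (subtopology (N_top k ell c) (V_gt k ell c R)) (N_proj k ell c) g"
    unfolding homeomorphic_maps_def V_gt_eq_image[OF ell]
  proof (intro conjI ballI)
    have "continuous_map (subtopology ?E (Rrays k ell)) (N_top k ell c) (N_proj k ell c)"
      by (rule quotient_imp_continuous_map[OF quotient_map_N_proj])
    then have "continuous_map (subtopology ?E ?W) (N_top k ell c) (N_proj k ell c)"
      by (rule continuous_map_from_subtopology_mono[OF _ sub])
    then show "continuous_map (subtopology ?E ?W) (subtopology (N_top k ell c) (N_proj k ell c ` ?W)) (N_proj k ell c)"
      by (auto simp: continuous_map_in_subtopology)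
    show "continuous_map (subtopology (N_top k ell c) (N_proj k ell c ` ?W)) (subtopology ?E ?W) g"
      using g gW by (auto simp: continuous_map_in_subtopology continuous_map_from_subtopology)
  qed (auto simp: gW)
  then show ?thesis unfolding homeomorphic_space_def by blast
qed

section \<open>Tempting sets are the unions of blocks\<close>

definition block_union :: "(nat \<Rightarrow> nat) \<Rightarrow> nat set \<Rightarrow> (nat \<times> nat) set" where
  "block_union ell J = (SIGMA j:J. {1..ell j})"

text \<open>
  The segment from \<open>x\<close> to the unit vector at \<open>(m, \<mu>)\<close> stays in the set: coordinate \<open>(m, \<nu>)\<close> keeps
  the minimum of block \<open>m\<close> at zero, and the other blocks are only scaled.
\<close>

lemma partial_block_contractible:
  assumes ell: "\<forall>j\<in>{1..k}. ell j \<ge> 1" and m: "m \<in> {1..k}"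
    and in_R: "\<mu> \<in> {1..ell m}" "(m, \<mu>) \<in> R" and not_R: "\<nu> \<in> {1..ell m}" "(m, \<nu>) \<notin> R"
  shows "contractible_space (subtopology (powertop_real UNIV) (reduced_supported k ell R))"
    and "reduced_supported k ell R \<noteq> {}"
proof -
  let ?E = "powertop_real (UNIV :: (nat \<times> nat) set)"
  let ?W = "reduced_supported k ell R"
  define e :: "nat \<times> nat \<Rightarrow> real" where "e r = (if r = (m, \<mu>) then 1 else 0)" for r
  have e0: "e r = 0" if "r \<noteq> (m, \<mu>)" for r using that by (simp add: e_def)
  have mem: "(\<lambda>r. (1 - t) * x r + t * e r) \<in> ?W"
    \<comment> \<open>The second alternative covers the apex itself, before it is known to lie in the set.\<close>
    if x: "x \<in> ?W \<or> t = 1 \<and> x = (\<lambda>_. 0)" and t: "0 \<le> t" "t \<le> 1" for x t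
  proof -
    have nonneg: "0 \<le> x r" for r using x reduced_nonneg[OF ell, of x r] by (auto simp: reduced_supported_def)
    have "\<exists>\<kappa>\<in>{1..ell j}. (1 - t) * x (j, \<kappa>) + t * e (j, \<kappa>) = 0" if j: "j \<in> {1..k}" for j
    proof (cases "j = m")
      case True
      then show ?thesis
        using x not_R in_R by (intro bexI[of _ \<nu>]) (auto simp: reduced_supported_def e_def)
    next
      case False
      have "ell j \<ge> 1" using ell j by blast
      then have "\<exists>\<kappa>\<in>{1..ell j}. x (j, \<kappa>) = 0"
        using x j by (auto simp: reduced_supported_def block_reduced_iff[OF ell])
      then show ?thesis using False by (auto simp: e_def)
    qed
    moreover have "(\<lambda>r. (1 - t) * x r + t * e r) \<in> Rrays k ell"
      using x m in_R by (auto simp: reduced_supported_def block_reduced_def Rrays_def e_def ray_index_def)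
    ultimately have "(\<lambda>r. (1 - t) * x r + t * e r) \<in> block_reduced k ell"
      using t nonneg by (auto simp: block_reduced_iff[OF ell] e_def)
    moreover have "\<exists>r. (1 - t) * x r + t * e r \<noteq> 0"
    proof (cases "t = 0")
      case True
      then show ?thesis using x by (auto simp: reduced_supported_def)
    next
      case False
      then have "(1 - t) * x (m, \<mu>) + t * e (m, \<mu>) > 0"
        using t nonneg[of "(m, \<mu>)"] by (simp add: e_def add_nonneg_pos)
      then show ?thesis by (metis less_irrefl)
    qed
    ultimately show ?thesis
      using x in_R by (auto simp: reduced_supported_def e_def)
  qed
  have "e \<in> ?W" using mem[of "\<lambda>_. 0" 1] by simp
  then show "?W \<noteq> {}" by blast
  let ?h = "\<lambda>(t, x) r. (1 - t) * x r + t * e r"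
  have "homotopic_with (\<lambda>x. True) (subtopology ?E ?W) (subtopology ?E ?W) id (\<lambda>x. e)"
    unfolding homotopic_with_def
  proof (intro exI[of _ ?h] conjI ballI allI)
    have "continuous_map (prod_topology (top_of_set {0..1}) (subtopology ?E ?W)) euclideanreal
        (\<lambda>z. (1 - fst z) * snd z r + fst z * e r)" for r
    proof -
      have "continuous_map (prod_topology (top_of_set {0..1::real}) (subtopology ?E ?W)) euclideanreal fst"
        using continuous_map_fst continuous_map_in_subtopology by blast
      moreover have "continuous_map (prod_topology (top_of_set {0..1::real}) (subtopology ?E ?W)) euclideanreal (\<lambda>z. snd z r)"
      proof -
        have "continuous_map (subtopology ?E ?W) euclideanreal (\<lambda>x. x r)"
          by (intro continuous_map_from_subtopology continuous_map_product_projection) simp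
        from continuous_map_compose[OF continuous_map_snd this] show ?thesis by (simp add: o_def)
      qed
      ultimately show ?thesis
        by (intro continuous_map_add continuous_map_real_mult continuous_map_diff) auto
    qed
    then show "continuous_map (prod_topology (top_of_set {0..1}) (subtopology ?E ?W)) (subtopology ?E ?W) ?h"
      using mem by (auto simp: continuous_map_in_subtopology continuous_map_componentwise_UNIV split_def)
  qed auto
  then show "contractible_space (subtopology ?E ?W)"
    unfolding contractible_space_def by blast
qed

text \<open>
  Coordinates on the block-reduced vectors supported on the blocks in \<open>J\<close> are the differences
  to the last entry of the block (\<open>D\<close>, indexed by a bijection \<open>\<beta>\<close> with an initial segment of the
  naturals); the inverse puts zero in the last entry and then subtracts the block minimum (\<open>f\<close>).
  Only the zero vector has zero differences, so normalizing \<open>D\<close> gives a map to the sphere.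
\<close>

lemma block_union_sphere_retract:
  assumes ell: "\<forall>j\<in>{1..k}. ell j \<ge> 2" and J: "J \<subseteq> {1..k}" "J \<noteq> {}"
  obtains n f r where
    "continuous_map (nsphere n) (subtopology (powertop_real UNIV) (reduced_supported k ell (block_union ell J))) f"
    "continuous_map (subtopology (powertop_real UNIV) (reduced_supported k ell (block_union ell J))) (nsphere n) r"
    "\<And>u. u \<in> topspace (nsphere n) \<Longrightarrow> r (f u) = u"
proof -
  have ell1: "\<forall>j\<in>{1..k}. ell j \<ge> 1" using ell by auto
  let ?E = "powertop_real (UNIV :: (nat \<times> nat) set)"
  let ?W = "reduced_supported k ell (block_union ell J)"
  define I where "I = (SIGMA j:J. {1..<ell j})"
  have "finite I" using J finite_subset unfolding I_def by (intro finite_SigmaI) auto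
  moreover have "I \<noteq> {}"
  proof -
    obtain j where "j \<in> J" using J by blast
    moreover from this have "ell j \<ge> 2" using J ell by blast
    ultimately have "(j, 1) \<in> I" by (simp add: I_def)
    then show ?thesis by blast
  qed
  ultimately obtain n where n: "card I = Suc n"
    by (metis card_0_eq not0_implies_Suc)
  obtain \<beta> where "bij_betw \<beta> {0..<card I} I"
    using ex_bij_betw_nat_finite[OF \<open>finite I\<close>] by blast
  then have \<beta>: "bij_betw \<beta> {..n} I"
    by (simp add: n atLeast0LessThan lessThan_Suc_atMost)
  define \<gamma> where "\<gamma> = inv_into {..n} \<beta>"
  have \<gamma>\<beta>: "\<gamma> (\<beta> i) = i" "\<beta> i \<in> I" if "i \<le> n" for i
    using \<beta> that by (auto simp: \<gamma>_def bij_betw_def)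
  have \<beta>\<gamma>: "\<beta> (\<gamma> r) = r" "\<gamma> r \<le> n" if "r \<in> I" for r
    using \<beta> that bij_betw_apply[OF bij_betw_inv_into[OF \<beta>]] by (auto simp: \<gamma>_def bij_betw_inv_into_right)
  define D where "D x i = (if i \<le> n then x (\<beta> i) - x (fst (\<beta> i), ell (fst (\<beta> i))) else 0)"
    for x :: "nat \<times> nat \<Rightarrow> real" and i
  define raw where "raw u r = (if r \<in> I then u (\<gamma> r) else 0)" for u :: "nat \<Rightarrow> real" and r
  define f where "f u r = (if r \<in> block_union ell J then raw u r - block_min ell (raw u) (fst r) else 0)"
    for u :: "nat \<Rightarrow> real" and r
  define r where "r x i = D x i / sqrt (\<Sum>j\<le>n. (D x j)\<^sup>2)" for x i
  have Df: "D (f u) i = u i" if "\<forall>i>n. u i = 0" for u i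
  proof (cases "i \<le> n")
    case True
    obtain j \<nu> where j: "\<beta> i = (j, \<nu>)" "j \<in> J" "\<nu> \<in> {1..<ell j}"
      using \<gamma>\<beta>(2)[OF True] by (auto simp: I_def)
    then have "(j, ell j) \<notin> I" "(j, ell j) \<in> block_union ell J" "(j, \<nu>) \<in> block_union ell J" "(j, \<nu>) \<in> I"
      by (auto simp: I_def block_union_def)
    then show ?thesis
      using True j \<gamma>\<beta>(1)[OF True] by (simp add: D_def f_def raw_def)
  qed (use that in \<open>simp add: D_def\<close>)
  have fW: "f u \<in> ?W" if u: "u \<in> topspace (nsphere n)" for u
  proof -
    have u': "\<forall>i>n. u i = 0" "(\<Sum>i\<le>n. (u i)\<^sup>2) = 1" using u by (auto simp: nsphere)
    have "\<exists>r. f u r \<noteq> 0"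
    proof (rule ccontr)
      assume "\<not> ?thesis"
      then have "u i = 0" for i using Df[OF u'(1), of i] by (simp add: D_def split: if_splits)
      then show False using u'(2) by simp
    qed
    moreover have "f u \<in> block_reduced k ell"
      unfolding block_reduced_iff[OF ell1]
    proof (intro conjI ballI)
      show "f u \<in> Rrays k ell" using J by (auto simp: Rrays_def f_def block_union_def ray_index_def)
      fix j assume j: "j \<in> {1..k}"
      show "0 \<le> f u (j, \<nu>)" if "\<nu> \<in> {1..ell j}" for \<nu>
        using block_min_le[of \<nu> ell j "raw u"] that by (simp add: f_def)
      have "ell j \<ge> 1" using ell1 j by blast
      show "\<exists>\<nu>\<in>{1..ell j}. f u (j, \<nu>) = 0"
        using block_min_attained[of ell j "raw u", OF \<open>ell j \<ge> 1\<close>] by (auto simp: f_def)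
    qed
    ultimately show ?thesis by (auto simp: reduced_supported_def f_def)
  qed
  have norm_pos: "(\<Sum>j\<le>n. (D x j)\<^sup>2) > 0" if x: "x \<in> ?W" for x
  proof (rule ccontr)
    assume "\<not> ?thesis"
    then have "(\<Sum>j\<le>n. (D x j)\<^sup>2) = 0" by (simp add: sum_nonneg order_antisym)
    then have D0: "D x i = 0" if "i \<le> n" for i using that by (simp add: sum_nonneg_eq_0_iff)
    have const: "x (j, \<nu>) = x (j, ell j)" if "j \<in> J" "\<nu> \<in> {1..ell j}" for j \<nu>
    proof (cases "\<nu> = ell j")
      case False
      then have "(j, \<nu>) \<in> I" using that by (auto simp: I_def)
      from D0[OF \<beta>\<gamma>(2)[OF this]] show ?thesis
        using \<beta>\<gamma>[OF \<open>(j, \<nu>) \<in> I\<close>] by (simp add: D_def)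
    qed simp
    have "x s = 0" for s
    proof (cases "s \<in> block_union ell J")
      case True
      then obtain j \<nu> where s: "s = (j, \<nu>)" "j \<in> J" "\<nu> \<in> {1..ell j}" by (auto simp: block_union_def)
      then obtain \<kappa> where "\<kappa> \<in> {1..ell j}" "x (j, \<kappa>) = 0"
        using x J unfolding reduced_supported_def block_reduced_iff[OF ell1] by blast
      then show ?thesis using const s by metis
    qed (use x in \<open>auto simp: reduced_supported_def\<close>)
    then show False using x by (auto simp: reduced_supported_def)
  qed
  have proj: "continuous_map (subtopology ?E ?W) euclideanreal (\<lambda>x. x s)" for s
    by (intro continuous_map_from_subtopology continuous_map_product_projection) simp
  have contD: "continuous_map (subtopology ?E ?W) euclideanreal (\<lambda>x. D x i)" for i
    unfolding D_def by (cases "i \<le> n") (auto intro!: continuous_map_diff proj)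
  have "continuous_map (subtopology ?E ?W) (nsphere n) r"
    unfolding nsphere continuous_map_in_subtopology
  proof
    have "continuous_map (subtopology ?E ?W) euclideanreal (\<lambda>x. r x i)" for i
      unfolding r_def
      by (intro continuous_map_real_divide continuous_map_sqrt continuous_map_sum continuous_map_real_pow contD)
        (auto dest!: norm_pos)
    then show "continuous_map (subtopology ?E ?W) (powertop_real UNIV) r"
      by (simp add: continuous_map_componentwise_UNIV)
    have "(\<Sum>i\<le>n. (r x i)\<^sup>2) = 1" "\<forall>i>n. r x i = 0" if "x \<in> ?W" for x
      using norm_pos[OF that] by (auto simp: r_def D_def[of x i for i] power_divide sum_nonneg simp flip: sum_divide_distrib)
    then show "r \<in> topspace (subtopology ?E ?W) \<rightarrow> {x. (\<Sum>i\<le>n. (x i)\<^sup>2) = 1 \<and> (\<forall>i>n. x i = 0)}"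
      by auto
  qed
  moreover have "continuous_map (nsphere n) (subtopology ?E ?W) f"
    unfolding continuous_map_in_subtopology
  proof
    have raw: "continuous_map (nsphere n) euclideanreal (\<lambda>u. raw u s)" for s
      unfolding raw_def by (cases "s \<in> I") (auto intro: continuous_map_nsphere_projection)
    have "continuous_map (nsphere n) euclideanreal (\<lambda>u. f u s)" for s
      unfolding f_def
      by (cases "s \<in> block_union ell J") (auto intro!: continuous_map_diff continuous_map_block_min raw)
    then show "continuous_map (nsphere n) ?E f"
      by (simp add: continuous_map_componentwise_UNIV)
    show "f \<in> topspace (nsphere n) \<rightarrow> ?W" using fW by blast
  qed
  moreover have "r (f u) = u" if "u \<in> topspace (nsphere n)" for u
  proof -
    have u: "\<forall>i>n. u i = 0" "(\<Sum>i\<le>n. (u i)\<^sup>2) = 1" using that by (auto simp: nsphere)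
    show ?thesis by (rule ext) (simp add: r_def Df[OF u(1)] u(2))
  qed
  ultimately show ?thesis using that by blast
qed

lemma field_acyclic_itself: "field_acyclic (F :: 'f::field itself) X = field_acyclic TYPE('f) X"
  by (simp add: field_acyclic_def)

theorem tempting_iff_block_union:
  fixes F :: "'f::field itself"
  assumes ell: "\<forall>j\<in>{1..k}. ell j \<ge> 2"
  shows "tempting F k ell c R \<longleftrightarrow> (\<exists>J\<subseteq>{1..k}. R = block_union ell J)"
proof
  have ell1: "\<forall>j\<in>{1..k}. ell j \<ge> 1" using ell by auto
  let ?V = "subtopology (N_top k ell c) (V_gt k ell c R)"
  let ?W = "subtopology (powertop_real UNIV) (reduced_supported k ell R)"
  have homeo: "?W homeomorphic_space ?V" by (rule V_gt_homeomorphic[OF ell])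
  show "\<exists>J\<subseteq>{1..k}. R = block_union ell J" if tempt: "tempting F k ell c R"
  proof (rule ccontr)
    assume no: "\<not> ?thesis"
    have R: "R \<subseteq> ray_index k ell" using tempt by (simp add: tempting_def)
    define J where "J = {j \<in> {1..k}. \<exists>\<mu>\<in>{1..ell j}. (j, \<mu>) \<in> R}"
    have "R \<subseteq> block_union ell J" using R by (auto simp: J_def block_union_def ray_index_def)
    moreover have "J \<subseteq> {1..k}" by (auto simp: J_def)
    then have "R \<noteq> block_union ell J" using no by blast
    ultimately obtain m \<nu> where "(m, \<nu>) \<in> block_union ell J" "(m, \<nu>) \<notin> R" by (metis subrelI subset_antisym)
    then obtain \<mu> where m: "m \<in> {1..k}" "\<mu> \<in> {1..ell m}" "(m, \<mu>) \<in> R" "\<nu> \<in> {1..ell m}" "(m, \<nu>) \<notin> R"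
      by (auto simp: J_def block_union_def)
    note W = partial_block_contractible[OF ell1 m]
    have "contractible_space ?V" using homeomorphic_space_contractibility[OF homeo] W(1) by simp
    moreover have "topspace ?V \<noteq> {}"
    proof -
      have "topspace ?W = reduced_supported k ell R" by simp
      then show ?thesis
        using W(2) homeomorphic_empty_space[OF homeo] null_topspace_iff_trivial by metis
    qed
    ultimately have "field_acyclic TYPE('f) ?V" by (rule contractible_imp_field_acyclic)
    then show False using tempt field_acyclic_itself[of F ?V] unfolding tempting_def by blast
  qed
  show "tempting F k ell c R" if union: "\<exists>J\<subseteq>{1..k}. R = block_union ell J"
  proof -
    obtain J where J: "J \<subseteq> {1..k}" and R: "R = block_union ell J" using union by blast
    have "\<not> field_acyclic TYPE('f) ?V"
    proof (cases "J = {}")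
      case True
      then have "reduced_supported k ell R = {}"
        by (auto simp: R block_union_def reduced_supported_def)
      then have "topspace ?V = {}" using V_gt_eq_image[OF ell, of c R] by simp
      then show ?thesis unfolding field_acyclic_def by blast
    next
      case False
      obtain n f r where f: "continuous_map (nsphere n) ?W f" and r: "continuous_map ?W (nsphere n) r"
        and rf: "\<And>u. u \<in> topspace (nsphere n) \<Longrightarrow> r (f u) = u"
        using block_union_sphere_retract[OF ell J False] unfolding R by metis
      obtain p q where pq: "homeomorphic_maps ?W ?V p q" using homeo by (auto simp: homeomorphic_space_def)
      show ?thesis
      proof (rule sphere_retract_not_field_acyclic)
        show "continuous_map (nsphere n) ?V (p \<circ> f)"
          using pq f by (auto simp: homeomorphic_maps_def intro: continuous_map_compose)
        show "continuous_map ?V (nsphere n) (r \<circ> q)"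
          using pq r by (auto simp: homeomorphic_maps_def intro: continuous_map_compose)
        show "(r \<circ> q) ((p \<circ> f) u) = u" if "u \<in> topspace (nsphere n)" for u
        proof -
          have "f u \<in> topspace ?W" using f that by (auto simp: continuous_map_def)
          then have "q (p (f u)) = f u" using pq by (simp add: homeomorphic_maps_def)
          then show ?thesis using rf[OF that] by simp
        qed
      qed
    qed
    moreover have "R \<subseteq> ray_index k ell" using J by (auto simp: R block_union_def ray_index_def)
    ultimately show ?thesis using field_acyclic_itself[of F ?V] unfolding tempting_def by blast
  qed
qed

section \<open>Chambers of the class map\<close>

text \<open>
  The sign conditions that define \<open>M(R)\<close> when \<open>R\<close> is the union of the blocks in \<open>J\<close>.  The
  coefficients are generic so that one argument serves the integral and the real loci.
\<close>

definition in_chamber ::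
  "nat \<Rightarrow> (nat \<Rightarrow> nat) \<Rightarrow> nat set \<Rightarrow> (nat \<times> nat \<Rightarrow> 'a::linordered_idom) \<Rightarrow> bool" where
  "in_chamber k ell J x \<longleftrightarrow>
     (\<forall>j\<in>{1..k}. \<forall>\<nu>\<in>{1..ell j}. if j \<in> J then x (j, \<nu>) \<le> -1 else 0 \<le> x (j, \<nu>))"

lemma class_map_row:
  assumes i: "i \<in> {1..k}"
  shows "class_map k ell c x i = (\<Sum>\<nu>=1..ell i. x (i, \<nu>))
    + (\<Sum>j=Suc i..k. \<Sum>\<nu>=1..ell j. of_int (c i j \<nu>) * x (j, \<nu>))"
proof -
  have "class_map k ell c x i = (\<Sum>j=1..k. \<Sum>\<nu>=1..ell j. of_int (pi_entry c i (j, \<nu>)) * x (j, \<nu>))"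
    using i by (simp add: class_map_def ray_index_def sum.Sigma split_def)
  also have "\<dots> = (\<Sum>j=i..k. \<Sum>\<nu>=1..ell j. of_int (pi_entry c i (j, \<nu>)) * x (j, \<nu>))"
    using i by (intro sum.mono_neutral_right) (auto simp: pi_entry_def)
  also have "\<dots> = (\<Sum>\<nu>=1..ell i. of_int (pi_entry c i (i, \<nu>)) * x (i, \<nu>))
      + (\<Sum>j=Suc i..k. \<Sum>\<nu>=1..ell j. of_int (pi_entry c i (j, \<nu>)) * x (j, \<nu>))"
    using i by (intro sum.atLeast_Suc_atMost) auto
  finally show ?thesis by (simp add: pi_entry_def)
qed

lemma class_map_outside: "i \<notin> {1..k} \<Longrightarrow> class_map k ell c x i = 0"
  unfolding class_map_def by (rule if_not_P)

lemma class_map_diff: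
  "class_map k ell c (\<lambda>r. x r - y r) i = class_map k ell c x i - class_map k ell c y i"
  by (simp add: class_map_def algebra_simps sum_subtractf)

lemma class_map_add:
  "class_map k ell c (\<lambda>r. x r + y r) i = class_map k ell c x i + class_map k ell c y i"
  by (simp add: class_map_def algebra_simps sum.distrib)

lemma class_map_of_int:
  "class_map k ell c (\<lambda>r. of_int (x r)) i = of_int (class_map k ell c x i)"
  by (simp add: class_map_def)

lemma in_chamber_of_int:
  "in_chamber k ell J (\<lambda>r. of_int (x r) :: 'a::linordered_idom) \<longleftrightarrow> in_chamber k ell J x"
proof -
  have "of_int z \<le> (-1::'a) \<longleftrightarrow> z \<le> -1" for z
    using of_int_le_iff[of z "-1", where 'a = 'a] by simp
  then show ?thesis by (simp add: in_chamber_def)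
qed

lemma chamber_set_eq:
  assumes J: "J \<subseteq> {1..k}"
  shows "{x. (\<forall>r\<in>ray_index k ell - block_union ell J. 0 \<le> x r) \<and> (\<forall>r\<in>block_union ell J. x r \<le> -1)}
    = {x. in_chamber k ell J x}"
proof (intro Collect_cong iffI)
  fix x :: "nat \<times> nat \<Rightarrow> 'a"
  assume x: "(\<forall>r\<in>ray_index k ell - block_union ell J. 0 \<le> x r) \<and> (\<forall>r\<in>block_union ell J. x r \<le> -1)"
  show "in_chamber k ell J x"
    unfolding in_chamber_def
  proof (intro ballI)
    fix j \<nu> assume "j \<in> {1..k}" "\<nu> \<in> {1..ell j}"
    then have "(j, \<nu>) \<in> ray_index k ell" "(j, \<nu>) \<in> block_union ell J \<longleftrightarrow> j \<in> J"
      by (auto simp: ray_index_def block_union_def)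
    then show "if j \<in> J then x (j, \<nu>) \<le> -1 else 0 \<le> x (j, \<nu>)"
      using x by auto
  qed
next
  fix x :: "nat \<times> nat \<Rightarrow> 'a"
  assume "in_chamber k ell J x"
  then have x: "if j \<in> J then x (j, \<nu>) \<le> -1 else 0 \<le> x (j, \<nu>)"
    if "j \<in> {1..k}" "\<nu> \<in> {1..ell j}" for j \<nu>
    using that by (simp add: in_chamber_def)
  show "(\<forall>r\<in>ray_index k ell - block_union ell J. 0 \<le> x r) \<and> (\<forall>r\<in>block_union ell J. x r \<le> -1)"
  proof (intro conjI ballI)
    fix r assume r: "r \<in> ray_index k ell - block_union ell J"
    obtain j \<nu> where "r = (j, \<nu>)" by (cases r)
    then show "0 \<le> x r"
      using r x[of j \<nu>] by (auto simp: ray_index_def block_union_def split: if_splits)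
  next
    fix r assume r: "r \<in> block_union ell J"
    obtain j \<nu> where "r = (j, \<nu>)" by (cases r)
    then show "x r \<le> -1"
      using r x[of j \<nu>] J by (simp add: block_union_def subset_iff)
  qed
qed

text \<open>
  Induction from the last row upwards: once the blocks below have vanished, row \<open>i\<close> says that the
  entries of block \<open>i\<close>, all of which have the same weak sign, sum to zero.  Entries that are at
  most \<open>-1\<close> cannot do so.
\<close>

lemma chamber_block_vanishes:
  fixes x :: "nat \<times> nat \<Rightarrow> 'a::linordered_idom"
  assumes ell: "\<forall>j\<in>{1..k}. ell j \<ge> 1" and x: "in_chamber k ell J x"
    and 0: "\<forall>i\<in>{m<..k}. class_map k ell c x i = 0"
    and i: "i \<in> {m<..k}"
  shows "i \<notin> J \<and> (\<forall>\<nu>\<in>{1..ell i}. x (i, \<nu>) = 0)"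
  using i
proof (induction "k - i" arbitrary: i rule: less_induct)
  case less
  have ik: "i \<in> {1..k}" using less.prems by auto
  have "(\<Sum>j=Suc i..k. \<Sum>\<nu>=1..ell j. of_int (c i j \<nu>) * x (j, \<nu>)) = 0"
    using less by (intro sum.neutral ballI) (auto simp: diff_less_mono2)
  then have sum0: "(\<Sum>\<nu>=1..ell i. x (i, \<nu>)) = 0"
    using bspec[OF 0 less.prems] class_map_row[OF ik, of ell c x] by simp
  have "i \<notin> J"
  proof
    assume "i \<in> J"
    then have "(\<Sum>\<nu>=1..ell i. x (i, \<nu>)) < (\<Sum>\<nu>=1..ell i. 0)"
      using x ik ell by (intro sum_strict_mono) (force simp: in_chamber_def)+
    then show False using sum0 by simp
  qed
  moreover from this have "\<forall>\<nu>\<in>{1..ell i}. x (i, \<nu>) = 0"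
    using sum_nonneg_eq_0_iff[of "{1..ell i}" "\<lambda>\<nu>. x (i, \<nu>)"] sum0 x ik by (auto simp: in_chamber_def)
  ultimately show ?case by blast
qed

lemma chamber_row_sum:
  fixes x :: "nat \<times> nat \<Rightarrow> 'a::linordered_idom"
  assumes ell: "\<forall>j\<in>{1..k}. ell j \<ge> 1" and x: "in_chamber k ell J x"
    and 0: "\<forall>i\<in>{m<..k}. class_map k ell c x i = 0"
    and m: "m \<in> {1..k}"
  shows "class_map k ell c x m = (\<Sum>\<nu>=1..ell m. x (m, \<nu>))"
proof -
  have "(\<Sum>j=Suc m..k. \<Sum>\<nu>=1..ell j. of_int (c m j \<nu>) * x (j, \<nu>)) = 0"
    using chamber_block_vanishes[OF ell x 0] m by (intro sum.neutral ballI) auto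
  then show ?thesis using class_map_row[OF m, of ell c x] by simp
qed

lemma chamber_block_sum_bounds:
  fixes x :: "nat \<times> nat \<Rightarrow> 'a::linordered_idom"
  assumes x: "in_chamber k ell J x" and m: "m \<in> {1..k}"
  shows "m \<in> J \<Longrightarrow> (\<Sum>\<nu>=1..ell m. x (m, \<nu>)) \<le> - of_nat (ell m)"
    and "m \<notin> J \<Longrightarrow> 0 \<le> (\<Sum>\<nu>=1..ell m. x (m, \<nu>))"
proof -
  show "(\<Sum>\<nu>=1..ell m. x (m, \<nu>)) \<le> - of_nat (ell m)" if "m \<in> J"
  proof -
    have "(\<Sum>\<nu>=1..ell m. x (m, \<nu>)) \<le> (\<Sum>\<nu>=1..ell m. -1)"
      using x m that by (intro sum_mono) (auto simp: in_chamber_def)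
    then show ?thesis by simp
  qed
  show "0 \<le> (\<Sum>\<nu>=1..ell m. x (m, \<nu>))" if "m \<notin> J"
    using x m that by (intro sum_nonneg) (auto simp: in_chamber_def)
qed

definition block_vector :: "nat \<Rightarrow> (nat \<Rightarrow> 'a) \<Rightarrow> nat \<times> nat \<Rightarrow> 'a::zero" where
  "block_vector m y r = (if fst r = m then y (snd r) else 0)"

lemma class_map_block_vector:
  assumes m: "m \<in> {1..k}"
  shows "class_map k ell c (block_vector m y) i =
    (if 1 \<le> i \<and> i < m then (\<Sum>\<nu>=1..ell m. of_int (c i m \<nu>) * y \<nu>)
     else if i = m then (\<Sum>\<nu>=1..ell m. y \<nu>) else 0)"
proof (cases "i \<in> {1..k}")
  case i: True
  have "(\<Sum>j=Suc i..k. \<Sum>\<nu>=1..ell j. of_int (c i j \<nu>) * block_vector m y (j, \<nu>))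
      = (\<Sum>j=Suc i..k. if j = m then \<Sum>\<nu>=1..ell m. of_int (c i m \<nu>) * y \<nu> else 0)"
    by (intro sum.cong) (auto simp: block_vector_def)
  then show ?thesis
    using i m by (simp add: class_map_row[OF i] block_vector_def)
next
  case False
  then show ?thesis using m by (auto simp: class_map_outside)
qed

lemma class_map_block_minus_one:
  assumes m: "m \<in> {1..k}"
  shows "class_map k ell c (block_vector m (\<lambda>_. -1)) i = - of_int (hull_vec ell c m i)"
  using m by (simp add: class_map_block_vector hull_vec_def sum_negf)

lemma seed_not_chamber_image:
  fixes x :: "nat \<times> nat \<Rightarrow> 'a::linordered_idom"
  assumes ell: "\<forall>j\<in>{1..k}. ell j \<ge> 1" and x: "in_chamber k ell J x"
    and a: "a \<in> Seed k ell"
  shows "(\<lambda>i. of_int (a i)) \<noteq> class_map k ell c x"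
proof
  assume eq: "(\<lambda>i. of_int (a i)) = class_map k ell c x"
  obtain m where m: "m \<in> {1..k}" "a \<in> Zpow m" "a m \<in> {- (int (ell m) - 1)..-1}"
    using a by (auto simp: Seed_def)
  have "class_map k ell c x i = 0" if "i \<in> {m<..k}" for i
    using m(2) that fun_cong[OF eq, of i] by (auto simp: Zpow_def)
  then have "\<forall>i\<in>{m<..k}. class_map k ell c x i = 0" by blast
  from chamber_row_sum[OF ell x this m(1)]
  have sum: "(\<Sum>\<nu>=1..ell m. x (m, \<nu>)) = of_int (a m)"
    using fun_cong[OF eq, of m] by simp
  show False
  proof (cases "m \<in> J")
    case True
    then have "of_int (a m) \<le> (of_int (- int (ell m)) :: 'a)"
      using chamber_block_sum_bounds(1)[OF x m(1)] sum by simp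
    then show False using m(3) by (simp only: of_int_le_iff) simp
  next
    case False
    then have "(of_int 0 :: 'a) \<le> of_int (a m)"
      using chamber_block_sum_bounds(2)[OF x m(1)] sum by simp
    then show False using m(3) by (simp only: of_int_le_iff) simp
  qed
qed

text \<open>
  Row \<open>m\<close> forces the sum over block \<open>m\<close> to be \<open>-\<ell>\<^sub>m\<close>.  The block is then negative with all
  entries \<open>-1\<close>, and its contribution to the class is minus the hull vector; deleting
  the block is the inverse of the hull step.
\<close>

lemma chamber_image_add_hull_vec:
  fixes x :: "nat \<times> nat \<Rightarrow> 'a::linordered_idom"
  assumes ell: "\<forall>j\<in>{1..k}. ell j \<ge> 1" and x: "in_chamber k ell J x"
    and m: "m \<in> {1..k}" and a: "\<And>i. m \<le> i \<Longrightarrow> a i = 0"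
    and eq: "\<And>i. class_map k ell c x i = of_int (a i - hull_vec ell c m i)"
  obtains x' where "in_chamber k ell (J - {m}) (x' :: nat \<times> nat \<Rightarrow> 'a)"
    "class_map k ell c x' = (\<lambda>i. of_int (a i))"
proof -
  have "class_map k ell c x i = 0" if "i \<in> {m<..k}" for i
    using eq a that by (simp add: hull_vec_def)
  then have "\<forall>i\<in>{m<..k}. class_map k ell c x i = 0" by blast
  from chamber_row_sum[OF ell x this m]
  have sum: "(\<Sum>\<nu>=1..ell m. x (m, \<nu>)) = - of_nat (ell m)"
    using eq[of m] a[of m] by (simp add: hull_vec_def)
  have mJ: "m \<in> J"
    using chamber_block_sum_bounds(2)[OF x m] sum ell m by force
  have "(\<Sum>\<nu>=1..ell m. -1 - x (m, \<nu>)) = 0"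
    using sum by (simp add: sum_subtractf)
  then have x1: "x (m, \<nu>) = -1" if "\<nu> \<in> {1..ell m}" for \<nu>
    using sum_nonneg_eq_0_iff[of "{1..ell m}" "\<lambda>\<nu>. -1 - x (m, \<nu>)"] that x m mJ
    by (auto simp: in_chamber_def)
  let ?x' = "\<lambda>r. x r - block_vector m (\<lambda>_. -1) r"
  have "in_chamber k ell (J - {m}) ?x'"
    using x x1 by (auto simp: in_chamber_def block_vector_def)
  moreover have "class_map k ell c ?x' = (\<lambda>i. of_int (a i))"
  proof
    fix i
    show "class_map k ell c ?x' i = of_int (a i)"
      unfolding class_map_diff by (simp add: eq class_map_block_minus_one[OF m])
  qed
  ultimately show ?thesis using that by blast
qed


section \<open>Immaculate loci and the hull of the seed\<close>

text \<open>
  The integral classes in the union of the \<open>M(R)\<close> over all unions of blocks \<open>R\<close>, with solutions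
  taken in the ring \<open>'a\<close>: the integral locus is the complement for \<open>int\<close>, the real one for \<open>real\<close>.
\<close>

definition chamber_class ::
  "'a::linordered_idom itself \<Rightarrow> nat \<Rightarrow> (nat \<Rightarrow> nat) \<Rightarrow> (nat \<Rightarrow> nat \<Rightarrow> nat \<Rightarrow> int) \<Rightarrow> (nat \<Rightarrow> int) \<Rightarrow> bool"
where
  "chamber_class _ k ell c a \<longleftrightarrow>
     (\<exists>J\<subseteq>{1..k}. \<exists>x :: nat \<times> nat \<Rightarrow> 'a. in_chamber k ell J x \<and> class_map k ell c x = (\<lambda>i. of_int (a i)))"

lemma chamber_class_int_imp:
  assumes "chamber_class TYPE(int) k ell c a"
  shows "chamber_class TYPE('a::linordered_idom) k ell c a"
proof -
  obtain J and x :: "nat \<times> nat \<Rightarrow> int" where J: "J \<subseteq> {1..k}" and x: "in_chamber k ell J x"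
    and eq: "class_map k ell c x = a"
    using assms by (auto simp: chamber_class_def)
  have "class_map k ell c (\<lambda>r. of_int (x r) :: 'a) = (\<lambda>i. of_int (a i))"
    using eq by (auto simp: class_map_of_int)
  then show ?thesis
    using J x in_chamber_of_int unfolding chamber_class_def by blast
qed

lemma not_chamber_class_diff_hull_vec:
  assumes ell: "\<forall>j\<in>{1..k}. ell j \<ge> 1" and a: "\<not> chamber_class TYPE('a::linordered_idom) k ell c a"
    and j: "j < k" "a \<in> Zpow j"
  shows "\<not> chamber_class TYPE('a) k ell c (\<lambda>i. a i - hull_vec ell c (Suc j) i)"
proof
  assume "chamber_class TYPE('a) k ell c (\<lambda>i. a i - hull_vec ell c (Suc j) i)"
  then obtain J and x :: "nat \<times> nat \<Rightarrow> 'a" where J: "J \<subseteq> {1..k}" and x: "in_chamber k ell J x"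
    and eq: "class_map k ell c x = (\<lambda>i. of_int (a i - hull_vec ell c (Suc j) i))"
    by (auto simp: chamber_class_def)
  obtain x' :: "nat \<times> nat \<Rightarrow> 'a" where "in_chamber k ell (J - {Suc j}) x'"
    "class_map k ell c x' = (\<lambda>i. of_int (a i))"
    by (rule chamber_image_add_hull_vec[OF ell x, where m = "Suc j" and a = a])
      (use j eq in \<open>auto simp: Zpow_def\<close>)
  then show False using a J unfolding chamber_class_def by blast
qed

text \<open>
  A hull step leaves \<open>-\<ell>\<^bsub>j+1\<^esub>\<close> as the new last nonzero entry, so every hull element has a
  last nonzero entry, and it is a seed value or \<open>-\<ell>\<^sub>m\<close>.  The upper bound is zero because the
  last nonzero entry may come before position \<open>j\<close>.
\<close>

lemma hull_last_entry_bounds: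
  assumes ell: "\<forall>j\<in>{1..k}. ell j \<ge> 1" and a: "a \<in> c_hull k ell c (Seed k ell)" "a \<in> Zpow j"
  shows "1 \<le> j \<and> - int (ell j) \<le> a j \<and> a j \<le> 0"
proof -
  have "\<exists>m\<in>{1..k}. a \<in> Zpow m \<and> a m \<in> {- int (ell m)..-1}"
    using a(1)
  proof cases
    case base
    then show ?thesis by (fastforce simp: Seed_def)
  next
    case (step b j)
    then have "a \<in> Zpow (Suc j)" "a (Suc j) = - int (ell (Suc j))"
      by (auto simp: Zpow_def hull_vec_def)
    moreover have "ell (Suc j) \<ge> 1" using ell step by auto
    ultimately show ?thesis using step(3) by (intro bexI[of _ "Suc j"]) auto
  qed
  then obtain m where m: "m \<in> {1..k}" "a \<in> Zpow m" "- int (ell m) \<le> a m" "a m \<le> -1" by auto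
  have "m \<le> j" using a(2) m by (force simp: Zpow_def)
  then show ?thesis
    using m by (cases "m = j") (auto simp: Zpow_def)
qed

text \<open>
  The solution for \<open>b\<close> vanishes on block \<open>j + 1\<close>, so the block is free to take the values \<open>y\<close>.
\<close>

lemma chamber_class_add_block:
  assumes ell: "\<forall>j\<in>{1..k}. ell j \<ge> 1" and j: "j < k"
    and b: "chamber_class TYPE(int) k ell c b" "b \<in> Zpow j"
    and y: "(\<forall>\<nu>\<in>{1..ell (Suc j)}. 0 \<le> y \<nu>) \<or> (\<forall>\<nu>\<in>{1..ell (Suc j)}. y \<nu> \<le> (-1::int))"
    and a: "\<And>i. a i = b i + class_map k ell c (block_vector (Suc j) y) i"
  shows "chamber_class TYPE(int) k ell c a"
proof -
  obtain J and x :: "nat \<times> nat \<Rightarrow> int" where J: "J \<subseteq> {1..k}" and x: "in_chamber k ell J x"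
    and eq: "class_map k ell c x = b"
    using b(1) by (auto simp: chamber_class_def)
  have "\<forall>i\<in>{j<..k}. class_map k ell c x i = 0"
    using b(2) eq by (auto simp: Zpow_def)
  from chamber_block_vanishes[OF ell x this, of "Suc j"] j
  have 0: "Suc j \<notin> J" "\<And>\<nu>. \<nu> \<in> {1..ell (Suc j)} \<Longrightarrow> x (Suc j, \<nu>) = 0"
    by auto
  let ?x = "\<lambda>r. x r + block_vector (Suc j) y r"
  have cm: "class_map k ell c ?x = (\<lambda>i. of_int (a i))"
    by (rule ext) (simp add: class_map_add eq a)
  from y show ?thesis
  proof
    assume "\<forall>\<nu>\<in>{1..ell (Suc j)}. 0 \<le> y \<nu>"
    then have "in_chamber k ell J ?x"
      using x 0 by (auto simp: in_chamber_def block_vector_def)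
    then show ?thesis using J cm unfolding chamber_class_def by blast
  next
    assume "\<forall>\<nu>\<in>{1..ell (Suc j)}. y \<nu> \<le> -1"
    then have "in_chamber k ell (insert (Suc j) J) ?x"
      using x 0 by (auto simp: in_chamber_def block_vector_def)
    moreover have "insert (Suc j) J \<subseteq> {1..k}" using J j by auto
    ultimately show ?thesis using cm unfolding chamber_class_def by blast
  qed
qed

lemma zero_chamber_class: "chamber_class TYPE(int) k ell c (\<lambda>_. 0)"
  unfolding chamber_class_def
  by (intro exI[of _ "{}"] exI[of _ "\<lambda>_. 0"] conjI) (auto simp: in_chamber_def class_map_def)

text \<open>
  Solve for the blocks from the last one down, keeping the remaining class outside the hull.  The
  gap condition provides the freedom to do so whenever the entry \<open>a\<^sub>m\<close> admits more than one
  distribution over block \<open>m\<close>; the remaining values of \<open>a\<^sub>m\<close> are the ones that the seed and the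
  hull step control.
\<close>

theorem outside_hull_chamber_class:
  assumes ell: "\<forall>j\<in>{1..k}. ell j \<ge> 1"
    and gap: "\<forall>j. 1 \<le> j \<and> j < k \<longrightarrow> (\<exists>\<mu>\<in>{1..ell (Suc j)}. \<exists>\<nu>\<in>{1..ell (Suc j)}.
              c j (Suc j) \<mu> - c j (Suc j) \<nu> > int (ell j))"
  shows "m \<le> k \<Longrightarrow> a \<in> Zpow m \<Longrightarrow> a \<notin> c_hull k ell c (Seed k ell) \<Longrightarrow> chamber_class TYPE(int) k ell c a"
proof (induction m arbitrary: a)
  case 0
  then have "a = (\<lambda>_. 0)" by (auto simp: Zpow_def)
  then show ?case by (simp add: zero_chamber_class)
next
  case (Suc j)
  let ?m = "Suc j" and ?H = "c_hull k ell c (Seed k ell)"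
  have j: "j < k" using Suc.prems by simp
  have ellm: "ell ?m \<ge> 1" using ell j by auto
  define contrib where "contrib y = class_map k ell c (block_vector ?m y)" for y :: "nat \<Rightarrow> int"
  have contrib: "contrib y i = (if 1 \<le> i \<and> i < ?m then (\<Sum>\<nu>=1..ell ?m. c i ?m \<nu> * y \<nu>)
     else if i = ?m then (\<Sum>\<nu>=1..ell ?m. y \<nu>) else 0)" for y i
    using j by (simp add: contrib_def class_map_block_vector)
  have reduce: "chamber_class TYPE(int) k ell c a"
    if y: "(\<forall>\<nu>\<in>{1..ell ?m}. 0 \<le> y \<nu>) \<or> (\<forall>\<nu>\<in>{1..ell ?m}. y \<nu> \<le> -1)"
      and sum: "(\<Sum>\<nu>=1..ell ?m. y \<nu>) = a ?m" and notin: "(\<lambda>i. a i - contrib y i) \<notin> ?H" for y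
  proof -
    let ?b = "\<lambda>i. a i - contrib y i"
    have b: "?b \<in> Zpow j"
      using Suc.prems(2) sum by (auto simp: Zpow_def contrib)
    have "chamber_class TYPE(int) k ell c ?b"
      using Suc.IH[OF _ b notin] j by simp
    then show ?thesis
      by (rule chamber_class_add_block[OF ell j _ b y]) (simp add: contrib_def)
  qed
  have spread: "chamber_class TYPE(int) k ell c a"
    if t: "t \<noteq> 0" "s * int (ell ?m) + t = a ?m" and st: "s = 0 \<and> 0 \<le> t \<or> s = -1 \<and> t \<le> 0" for s t
  proof -
    \<comment> \<open>The block is constantly \<open>s\<close> except that entry \<open>\<kappa>\<close> absorbs the excess \<open>t\<close>.\<close>
    define y where "y \<kappa> \<nu> = s + (if \<nu> = \<kappa> then t else 0)" for \<kappa> \<nu> :: nat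
    have y: "(\<forall>\<nu>\<in>{1..ell ?m}. 0 \<le> y \<kappa> \<nu>) \<or> (\<forall>\<nu>\<in>{1..ell ?m}. y \<kappa> \<nu> \<le> -1)" for \<kappa>
      using st by (auto simp: y_def)
    have sum: "(\<Sum>\<nu>=1..ell ?m. y \<kappa> \<nu>) = a ?m" if "\<kappa> \<in> {1..ell ?m}" for \<kappa>
      using that t(2) by (simp add: y_def sum.distrib mult.commute)
    have "\<exists>\<kappa>\<in>{1..ell ?m}. (\<lambda>i. a i - contrib (y \<kappa>) i) \<notin> ?H"
    proof (rule ccontr)
      assume "\<not> ?thesis"
      then have H: "(\<lambda>i. a i - contrib (y \<kappa>) i) \<in> ?H" if "\<kappa> \<in> {1..ell ?m}" for \<kappa>
        using that by blast
      have Z: "(\<lambda>i. a i - contrib (y \<kappa>) i) \<in> Zpow j" if "\<kappa> \<in> {1..ell ?m}" for \<kappa>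
        using Suc.prems(2) sum[OF that] by (auto simp: Zpow_def contrib)
      note bounds = hull_last_entry_bounds[OF ell H Z]
      have j1: "1 \<le> j" using bounds[of 1] ellm by auto
      then obtain \<mu> \<nu> where \<mu>\<nu>: "\<mu> \<in> {1..ell ?m}" "\<nu> \<in> {1..ell ?m}"
        and gap': "c j ?m \<mu> - c j ?m \<nu> > int (ell j)" using gap j by blast
      have cj: "contrib (y \<kappa>) j = s * (\<Sum>\<nu>=1..ell ?m. c j ?m \<nu>) + t * c j ?m \<kappa>"
        if "\<kappa> \<in> {1..ell ?m}" for \<kappa>
      proof -
        have "(\<Sum>\<nu>=1..ell ?m. c j ?m \<nu> * y \<kappa> \<nu>)
          = (\<Sum>\<nu>=1..ell ?m. s * c j ?m \<nu> + (if \<nu> = \<kappa> then t * c j ?m \<kappa> else 0))"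
          by (intro sum.cong) (auto simp: y_def algebra_simps)
        also have "\<dots> = s * (\<Sum>\<nu>=1..ell ?m. c j ?m \<nu>) + t * c j ?m \<kappa>"
          using that by (simp add: sum.distrib sum_distrib_left)
        finally show ?thesis using j1 by (simp add: contrib)
      qed
      have "\<bar>t * c j ?m \<mu> - t * c j ?m \<nu>\<bar> \<le> int (ell j)"
        using bounds[OF \<mu>\<nu>(1) \<mu>\<nu>(1)] bounds[OF \<mu>\<nu>(2) \<mu>\<nu>(2)] cj[OF \<mu>\<nu>(1)] cj[OF \<mu>\<nu>(2)] by linarith
      moreover have "\<bar>t * c j ?m \<mu> - t * c j ?m \<nu>\<bar> = \<bar>t\<bar> * (c j ?m \<mu> - c j ?m \<nu>)"
        using gap' by (simp add: abs_mult flip: right_diff_distrib)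
      moreover have "1 * (c j ?m \<mu> - c j ?m \<nu>) \<le> \<bar>t\<bar> * (c j ?m \<mu> - c j ?m \<nu>)"
        using t(1) gap' by (intro mult_right_mono) auto
      ultimately show False using gap' by (metis mult_1 not_le order_trans)
    qed
    then show ?thesis using reduce y sum by blast
  qed
  consider "a ?m = 0" | "a ?m \<in> {- (int (ell ?m) - 1)..-1}" | "a ?m = - int (ell ?m)"
    | "a ?m > 0" | "a ?m < - int (ell ?m)" by fastforce
  then show ?case
  proof cases
    case 1
    then have "a \<in> Zpow j" using Suc.prems(2) le_Suc_eq by (auto simp: Zpow_def)
    then show ?thesis using Suc.IH Suc.prems by simp
  next
    case 2
    then have "a \<in> Seed k ell" using Suc.prems unfolding Seed_def by auto
    then show ?thesis using Suc.prems(3) c_hull.base by blast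
  next
    case 3
    show ?thesis
    proof (rule reduce[of "\<lambda>_. -1"])
      show "(\<lambda>i. a i - contrib (\<lambda>_. -1) i) \<notin> ?H"
      proof
        assume H: "(\<lambda>i. a i - contrib (\<lambda>_. -1) i) \<in> ?H"
        have eq: "contrib (\<lambda>_. -1) i = - hull_vec ell c ?m i" for i
          using j class_map_block_minus_one[of ?m k ell c i, where 'a = int] by (simp add: contrib_def)
        have "(\<lambda>i. a i - contrib (\<lambda>_. -1) i) \<in> Zpow j"
          using Suc.prems(2) 3 le_Suc_eq by (auto simp: Zpow_def contrib)
        from c_hull.step[OF H j this] have "a \<in> ?H" by (simp add: eq)
        then show False using Suc.prems(3) by contradiction
      qed
    qed (use 3 in auto)
  next
    case 4
    then show ?thesis using spread[of "a ?m" 0] by auto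
  next
    case 5
    then show ?thesis using spread[of "a ?m + int (ell ?m)" "-1"] by auto
  qed
qed

theorem immaculate_loci_from_tempting:
  fixes F :: "'f::field itself"
  assumes tempting: "\<And>R. tempting F k ell c R \<longleftrightarrow> (\<exists>J\<subseteq>{1..k}. R = block_union ell J)"
  shows "Imm_int F k ell c = {a \<in> Zpow k. \<not> chamber_class TYPE(int) k ell c a}"
    and "Imm_real F k ell c = {a \<in> Zpow k. \<not> chamber_class TYPE(real) k ell c a}"
proof -
  have "a \<in> M_int k ell c (block_union ell J) \<longleftrightarrow> (\<exists>x. in_chamber k ell J x \<and> class_map k ell c x = a)"
    if "J \<subseteq> {1..k}" for a J
    unfolding M_int_def chamber_set_eq[OF that] by auto
  then show "Imm_int F k ell c = {a \<in> Zpow k. \<not> chamber_class TYPE(int) k ell c a}"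
    by (auto simp: Imm_int_def tempting chamber_class_def)
  have "a \<in> M_real k ell c (block_union ell J) \<longleftrightarrow> (\<exists>x. in_chamber k ell J x \<and> class_map k ell c x = a)"
    if "J \<subseteq> {1..k}" for a J
    unfolding M_real_def chamber_set_eq[OF that] by auto
  then show "Imm_real F k ell c = {a \<in> Zpow k. \<not> chamber_class TYPE(real) k ell c a}"
    by (auto simp: Imm_real_def tempting chamber_class_def)
qed

lemma closed_if_step_closed:
  assumes "\<And>a j. a \<in> S \<Longrightarrow> j < k \<Longrightarrow> a \<in> Zpow j \<Longrightarrow> (\<lambda>i. a i - hull_vec ell c (Suc j) i) \<in> S"
  shows "c_hull_closed k ell c S"
proof -
  have "a \<in> S" if "a \<in> c_hull k ell c S" for a
    using that by induction (auto intro: assms)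
  then show ?thesis unfolding c_hull_closed_def using c_hull.base by blast
qed

lemma c_hull_mono: "G \<subseteq> G' \<Longrightarrow> c_hull k ell c G \<subseteq> c_hull k ell c G'"
proof
  fix a assume "G \<subseteq> G'" "a \<in> c_hull k ell c G"
  from this(2,1) show "a \<in> c_hull k ell c G'"
    by induction (auto intro: c_hull.intros)
qed

lemma chamber_free_closed:
  assumes ell: "\<forall>j\<in>{1..k}. ell j \<ge> 1"
  shows "c_hull_closed k ell c {a \<in> Zpow k. \<not> chamber_class TYPE('a::linordered_idom) k ell c a}"
proof (rule closed_if_step_closed)
  fix a j assume a: "a \<in> {a \<in> Zpow k. \<not> chamber_class TYPE('a) k ell c a}" and j: "j < k" "a \<in> Zpow j"
  then have "(\<lambda>i. a i - hull_vec ell c (Suc j) i) \<in> Zpow k"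
    by (auto simp: Zpow_def hull_vec_def)
  then show "(\<lambda>i. a i - hull_vec ell c (Suc j) i) \<in> {a \<in> Zpow k. \<not> chamber_class TYPE('a) k ell c a}"
    using not_chamber_class_diff_hull_vec[OF ell _ j] a by blast
qed

lemma seed_chamber_free:
  assumes ell: "\<forall>j\<in>{1..k}. ell j \<ge> 1"
  shows "Seed k ell \<subseteq> {a \<in> Zpow k. \<not> chamber_class TYPE('a::linordered_idom) k ell c a}"
proof
  fix a assume a: "a \<in> Seed k ell"
  then have "a \<in> Zpow k" by (fastforce simp: Seed_def Zpow_def)
  moreover have "\<not> chamber_class TYPE('a) k ell c a"
    using seed_not_chamber_image[OF ell _ a] unfolding chamber_class_def by metis
  ultimately show "a \<in> {a \<in> Zpow k. \<not> chamber_class TYPE('a) k ell c a}" by blast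
qed

theorem theorem7p12:
  fixes k :: nat
    and ell :: "nat \<Rightarrow> nat"
    and c :: "nat \<Rightarrow> nat \<Rightarrow> nat \<Rightarrow> int"
    and F :: "'f::alg_closed_field itself"
  assumes ell: "\<forall>j\<in>{1..k}. ell j \<ge> 2"
    and c: "\<forall>i j \<nu>. 1 \<le> i \<and> i < j \<and> j \<le> k \<and> 1 \<le> \<nu> \<and> \<nu> \<le> ell j \<longrightarrow> c i j \<nu> \<le> 0"
  shows "Seed k ell \<subseteq> Imm_real F k ell c
    \<and> (c_hull_closed k ell c (Imm_int F k ell c) \<and> c_hull_closed k ell c (Imm_real F k ell c))
    \<and> ((\<forall>j. 1 \<le> j \<and> j < k \<longrightarrow>
           (\<exists>\<mu>\<in>{1..ell (Suc j)}. \<exists>\<nu>\<in>{1..ell (Suc j)}.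
              c j (Suc j) \<mu> - c j (Suc j) \<nu> > int (ell j)))
        \<longrightarrow> Imm_int F k ell c = Imm_real F k ell c
          \<and> Imm_real F k ell c = c_hull k ell c (Seed k ell))"
proof -
  have ell1: "\<forall>j\<in>{1..k}. ell j \<ge> 1" using ell by auto
  note Imm = immaculate_loci_from_tempting[OF tempting_iff_block_union[OF ell], of F c]
  have seed: "Seed k ell \<subseteq> Imm_real F k ell c"
    unfolding Imm by (rule seed_chamber_free[OF ell1])
  have closed: "c_hull_closed k ell c (Imm_int F k ell c)" "c_hull_closed k ell c (Imm_real F k ell c)"
    unfolding Imm by (rule chamber_free_closed[OF ell1])+
  have "Imm_real F k ell c \<subseteq> Imm_int F k ell c"
    unfolding Imm using chamber_class_int_imp by blast
  moreover have "c_hull k ell c (Seed k ell) \<subseteq> Imm_real F k ell c"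
    using c_hull_mono[OF seed, of k ell c] closed(2)[unfolded c_hull_closed_def, symmetric] by (rule ord_le_eq_trans)
  moreover have "Imm_int F k ell c \<subseteq> c_hull k ell c (Seed k ell)"
    if "\<forall>j. 1 \<le> j \<and> j < k \<longrightarrow> (\<exists>\<mu>\<in>{1..ell (Suc j)}. \<exists>\<nu>\<in>{1..ell (Suc j)}.
              c j (Suc j) \<mu> - c j (Suc j) \<nu> > int (ell j))"
    unfolding Imm using outside_hull_chamber_class[of k ell c k] ell1 that by blast
  ultimately show ?thesis using seed closed by (intro conjI impI) blast+
qed

end
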